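(* Let $A\in\mathbb{C}^{n\times n}$ be of the form $A=N+\mathbf{u}\mathbf{v}^H$ with $\mathbf{u},\mathbf{v}\in\mathbb{C}^n$ and $N$ normal ($NN^H-N^HN=0$), where $$a_{2,0}N^2+a_{1,1}NN^H+a_{0,2}(N^H)^2+a_{1,0}N+a_{0,1}N^H+a_{0,0}I_n=0$$ for complex coefficients satisfying $a_{k,j}=\overline{a_{j,k}}$ and $$a_{2,0}+a_{0,2}-a_{1,1}\neq0.$$ Then $$\mathcal{K}_j(A_{AH},Z)\subseteq\mathcal{K}_j(A_H,Z)\quad\text{for each } j\ge0,$$ whenever the columns of $Z$ span the subspace $$\mathcal{D}_s=\mathrm{span}\{\mathbf{u},\mathbf{v},A^H\mathbf{u},A^H\mathbf{v},A\mathbf{u},A\mathbf{v}\}.$$ Hence, if the block Lanczos process applied to $A_H$ with initial matrix $Z$ does not break down, the unitary matrix $U$ it produces, which transforms $A_H$ to block tridiagonal form $U^HA_HU$, also brings $A_{AH}$ to block tridiagonal form $U^HA_{AH}U$, and hence $A$ is also brought to block tridiagonal form $U^HAU$, with blocks of size at most 6 (all with respect to the block partition produced by the process).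
   Context: $A^H$ is the conjugate transpose of $A$. The Hermitian and antihermitian parts of $A$ are $A_H=\frac{A+A^H}{2}$ and $A_{AH}=\frac{A-A^H}{2}$. The matrix $Z$ lies in $\mathbb{C}^{n\times\ell}$ with $\ell\le6$. Block Krylov subspaces: for $H\in\mathbb{C}^{n\times n}$ and $Z\in\mathbb{C}^{n\times\ell}$, $\mathcal{K}_j(H,Z)$ is the span of the columns of $Z,HZ,\dots,H^{j-1}Z$. Block Lanczos process: given a Hermitian $H\in\mathbb{C}^{n\times n}$ and a nonzero $Z\in\mathbb{C}^{n\times \ell}$, $\ell\le n$, let the columns of $U_1$ be an orthonormal basis of the column space of $Z$. For $k\ge1$, while the total number of columns of $U_1,\dots,U_k$ is less than $n$, form $W=HU_k-U_kU_k^HHU_k-U_{k-1}U_{k-1}^HHU_k$ (the last term is absent for $k=1$). If $W=0$ the process breaks down (premature stop); otherwise the columns of $U_{k+1}$ are an orthonormal basis of the column space of $W$ (left singular vectors of $W$ for its nonzero singular values). If there is no premature stop, the output is the unitary matrix $U=[U_1|\cdots|U_p]\in\mathbb{C}^{n\times n}$, with $U_k\in\mathbb{C}^{n\times i_k}$, $\ell\ge i_1\ge i_2\ge\dots\ge i_p$, $i_1+\dots+i_p=n$. "Block tridiagonal" means block tridiagonal with respect to the partition $(i_1,\dots,i_p)$; the block sizes are the $i_k$. *)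

theory Defs
  imports "Jordan_Normal_Form.Schur_Decomposition" "Jordan_Normal_Form.VS_Connect"
begin

notation mat_adjoint (\<open>(_\<^sup>H)\<close> [1000] 999)

abbreviation cspan :: "nat \<Rightarrow> complex vec set \<Rightarrow> complex vec set" where
  "cspan n S \<equiv> LinearCombinations.module.span class_ring (module_vec TYPE(complex) n) S"

abbreviation ccol_space :: "nat \<Rightarrow> complex mat \<Rightarrow> complex vec set" where
  "ccol_space n B \<equiv> vec_space.col_space n B"

definition herm_part :: "complex mat \<Rightarrow> complex mat" where
  "herm_part A = (1/2) \<cdot>\<^sub>m (A + A\<^sup>H)"

definition antiherm_part :: "complex mat \<Rightarrow> complex mat" where
  "antiherm_part A = (1/2) \<cdot>\<^sub>m (A - A\<^sup>H)"

definition unitary_mat :: "nat \<Rightarrow> complex mat \<Rightarrow> bool" where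
  "unitary_mat n U \<longleftrightarrow> U \<in> carrier_mat n n \<and> U\<^sup>H * U = 1\<^sub>m n \<and> U * U\<^sup>H = 1\<^sub>m n"

text \<open>For \<open>j = 0\<close> this is the zero subspace.\<close>
definition krylov :: "nat \<Rightarrow> nat \<Rightarrow> complex mat \<Rightarrow> complex mat \<Rightarrow> complex vec set" where
  "krylov n j H Z = cspan n (\<Union>i<j. set (cols (H ^\<^sub>m i * Z)))"

definition orthonormal_basis_mat :: "nat \<Rightarrow> complex mat \<Rightarrow> complex vec set \<Rightarrow> bool" where
  "orthonormal_basis_mat n U S \<longleftrightarrow>
     dim_row U = n \<and> U\<^sup>H * U = 1\<^sub>m (dim_col U) \<and> cspan n (set (cols U)) = S"

definition total_cols :: "complex mat list \<Rightarrow> nat" where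
  "total_cols Us = sum_list (map dim_col Us)"

definition hcat :: "nat \<Rightarrow> complex mat list \<Rightarrow> complex mat" where
  "hcat n Us = mat_of_cols n (concat (map cols Us))"

text \<open>The matrix \<open>W\<close> computed from the nonempty list \<open>[U\<^sub>1, \<dots>, U\<^sub>k]\<close>.
  The list index is zero-based, so \<open>U\<^sub>k\<close> is \<open>Us ! (length Us - 1)\<close>.\<close>
definition lanczos_residual :: "complex mat \<Rightarrow> complex mat list \<Rightarrow> complex mat" where
  "lanczos_residual H Us =
     (let k = length Us;
          U = Us ! (k - 1);
          W = H * U - U * U\<^sup>H * H * U
      in if k = 1 then W
         else let U' = Us ! (k - 2) in W - U' * U'\<^sup>H * H * U)"

text \<open>\<open>block_lanczos_run n l H Z Us\<close>: the process started from \<open>H\<close> and \<open>Z\<close> can construct the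
  blocks \<open>Us = [U\<^sub>1, \<dots>, U\<^sub>k]\<close>. It is a relation because every choice of orthonormal
  bases is admitted. A run can be extended only if \<open>W \<noteq> 0\<close>.\<close>
inductive block_lanczos_run ::
    "nat \<Rightarrow> nat \<Rightarrow> complex mat \<Rightarrow> complex mat \<Rightarrow> complex mat list \<Rightarrow> bool"
  for n l :: nat and H Z :: "complex mat" where
  init: "\<lbrakk>H \<in> carrier_mat n n; H\<^sup>H = H; Z \<in> carrier_mat n l; Z \<noteq> 0\<^sub>m n l; l \<le> n;
      orthonormal_basis_mat n U (ccol_space n Z)\<rbrakk>
    \<Longrightarrow> block_lanczos_run n l H Z [U]"
| step: "\<lbrakk>block_lanczos_run n l H Z Us; total_cols Us < n;
      W = lanczos_residual H Us; W \<noteq> 0\<^sub>m n (dim_col (last Us));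
      orthonormal_basis_mat n U (ccol_space n W)\<rbrakk>
    \<Longrightarrow> block_lanczos_run n l H Z (Us @ [U])"

text \<open>A run that ends because the loop condition \<open>total_cols Us < n\<close> fails, i.e. not because of
  a breakdown \<open>W = 0\<close>.\<close>
definition block_lanczos_completes ::
    "nat \<Rightarrow> nat \<Rightarrow> complex mat \<Rightarrow> complex mat \<Rightarrow> complex mat list \<Rightarrow> bool" where
  "block_lanczos_completes n l H Z Us \<longleftrightarrow>
     block_lanczos_run n l H Z Us \<and> \<not> total_cols Us < n"

text \<open>Row (column) \<open>r\<close> of block row (column) \<open>p\<close> has global index
  \<open>sum_list (take p sizes) + r\<close>.\<close>
definition block_tridiagonal :: "nat list \<Rightarrow> complex mat \<Rightarrow> bool" where
  "block_tridiagonal sizes B \<longleftrightarrow>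
     B \<in> carrier_mat (sum_list sizes) (sum_list sizes) \<and>
     (\<forall>p q r c. p < length sizes \<longrightarrow> q < length sizes \<longrightarrow> r < sizes ! p \<longrightarrow> c < sizes ! q \<longrightarrow>
        p + 1 < q \<or> q + 1 < p \<longrightarrow>
        B $$ (sum_list (take p sizes) + r, sum_list (take q sizes) + c) = 0)"

end

theory Submission
  imports Defs "Jordan_Normal_Form.DL_Rank"
begin

text \<open>
  Write \<open>H\<close> for the Hermitian part of \<open>A\<close> and \<open>K j\<close> for the Krylov subspace \<open>krylov n j H Z\<close>. The proof
  rests on the fact that \<open>A\<close>, \<open>A\<^sup>H\<close> and the antihermitian part of \<open>A\<close> all map \<open>K j\<close> into \<open>K (j + 1)\<close>, exactly
  as \<open>H\<close> does by construction.

  All these matrices are combinations of \<open>H\<close>, of \<open>N\<close> and of matrices with range in the span of \<open>u\<close> and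
  \<open>v\<close>, and \<open>K 1\<close> contains \<open>u\<close> and \<open>v\<close>; so \<open>N\<close> is the matrix to study (\<open>N_shift\<close>). As \<open>N\<close> is normal, it
  commutes with \<open>N + N\<^sup>H\<close>, which is \<open>2 H\<close> up to rank two. Hence it is enough that \<open>N\<close> maps \<open>K 1\<close>
  into \<open>K 2\<close>, that is, that \<open>N N w\<close> and \<open>N N\<^sup>H w\<close> lie in \<open>K 2\<close> for \<open>w\<close> among \<open>u\<close> and \<open>v\<close>. Now \<open>N w\<close> and
  \<open>N\<^sup>H w\<close> lie in \<open>K 1\<close>, so \<open>N + N\<^sup>H\<close> maps them into \<open>K 2\<close>; modulo \<open>K 2\<close> this identifies \<open>N N w\<close> and
  \<open>N\<^sup>H N\<^sup>H w\<close> with \<open>- N N\<^sup>H w\<close>. The quadric leaves \<open>(a\<^sub>1\<^sub>1 - a\<^sub>2\<^sub>0 - a\<^sub>0\<^sub>2) N N\<^sup>H w = 0\<close> modulo \<open>K 2\<close>, and its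
  coefficient does not vanish (\<open>quadric_shift\<close>). The inclusion of Krylov subspaces follows by
  induction (\<open>krylov_subset_krylov\<close>).

  For the block Lanczos process, an invariant states that the blocks are orthonormal and that the
  first \<open>k\<close> of them span \<open>K k\<close>; it is preserved because \<open>H\<close> is Hermitian, so that subtracting two
  projections makes the residual orthogonal to all previous blocks (\<open>residual_orthogonal\<close>,
  \<open>lanczos_blocks_extend\<close>). If \<open>B\<close> and \<open>B\<^sup>H\<close> map each \<open>K j\<close> into \<open>K (j + 1)\<close>, then \<open>B\<close> moves a column of a block at most
  one block further, up to earlier blocks, and so does \<open>B\<^sup>H\<close>. Therefore \<open>U\<^sup>H B U\<close> is block
  tridiagonal (\<open>block_tridiagonal_hcat\<close>), in particular for \<open>H\<close>, for the antihermitian part and for \<open>A\<close>.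
\<close>

section \<open>Subspaces and spans\<close>

text \<open>Subspaces of \<open>\<complex>\<^sup>n\<close> enter the proof only through four operations: a span is a subspace, it is
the least one that contains its generators, preimages of subspaces under a matrix are subspaces,
and so are orthogonal complements. Every inclusion between Krylov subspaces below is checked on
generators with the help of these operations.\<close>

abbreviation csubspace :: "nat \<Rightarrow> complex vec set \<Rightarrow> bool" where
  "csubspace n M \<equiv> submodule class_ring M (module_vec TYPE(complex) n)"

lemma csubspace_iff:
  "csubspace n M \<longleftrightarrow> M \<subseteq> carrier_vec n \<and> 0\<^sub>v n \<in> M \<and>
     (\<forall>x\<in>M. \<forall>y\<in>M. x + y \<in> M) \<and> (\<forall>c. \<forall>x\<in>M. c \<cdot>\<^sub>v x \<in> M)"
  using vec_module[of n] unfolding submodule_def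
  by (auto simp: module_vec_simps class_ring_simps)

lemma csubspaceI:
  assumes "M \<subseteq> carrier_vec n" "0\<^sub>v n \<in> M"
    and "\<And>x y. x \<in> M \<Longrightarrow> y \<in> M \<Longrightarrow> x + y \<in> M" "\<And>c x. x \<in> M \<Longrightarrow> c \<cdot>\<^sub>v x \<in> M"
  shows "csubspace n M"
  using assms unfolding csubspace_iff by blast

lemma csubspaceD:
  assumes "csubspace n M"
  shows csubspace_carrier: "x \<in> M \<Longrightarrow> x \<in> carrier_vec n"
    and csubspace_zero: "0\<^sub>v n \<in> M"
    and csubspace_add: "x \<in> M \<Longrightarrow> y \<in> M \<Longrightarrow> x + y \<in> M"
    and csubspace_smult: "x \<in> M \<Longrightarrow> c \<cdot>\<^sub>v x \<in> M"
  using assms unfolding csubspace_iff by blast+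

lemma csubspace_diff:
  assumes M: "csubspace n M" and x: "x \<in> M" and y: "y \<in> M"
  shows "x - y \<in> M"
proof -
  have "x - y = x + (-1) \<cdot>\<^sub>v y"
    using csubspace_carrier[OF M x] csubspace_carrier[OF M y] by (intro eq_vecI) auto
  then show ?thesis using csubspace_add[OF M x csubspace_smult[OF M y]] by metis
qed

lemma csubspace_cspan:
  assumes "S \<subseteq> carrier_vec n"
  shows "csubspace n (cspan n S)"
proof -
  interpret vec_space "TYPE(complex)" n .
  show ?thesis using span_is_submodule assms by simp
qed

lemma cspan_superset:
  assumes "S \<subseteq> carrier_vec n"
  shows "S \<subseteq> cspan n S"
proof -
  interpret vec_space "TYPE(complex)" n .
  show ?thesis using in_own_span assms by simp
qed

lemma cspan_minimal:
  assumes "csubspace n M" and "S \<subseteq> M"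
  shows "cspan n S \<subseteq> M"
proof -
  interpret vec_space "TYPE(complex)" n .
  show ?thesis using span_is_subset assms by simp
qed

lemma csubspace_preimage:
  assumes B: "B \<in> carrier_mat n n" and M: "csubspace n M"
  shows "csubspace n {x \<in> carrier_vec n. B *\<^sub>v x \<in> M}"
proof (rule csubspaceI)
  have "B *\<^sub>v 0\<^sub>v n = 0\<^sub>v n"
    using B by (intro eq_vecI) (auto simp: scalar_prod_def)
  then show "0\<^sub>v n \<in> {x \<in> carrier_vec n. B *\<^sub>v x \<in> M}"
    using csubspace_zero[OF M] by simp
qed (use B csubspace_add[OF M] csubspace_smult[OF M] in
      \<open>auto simp: mult_add_distrib_mat_vec[OF B] mult_mat_vec[OF B]\<close>)

lemma cspan_image_subset:
  assumes B: "B \<in> carrier_mat n n" and M: "csubspace n M" and S: "S \<subseteq> carrier_vec n"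
    and gen: "\<And>s. s \<in> S \<Longrightarrow> B *\<^sub>v s \<in> M" and x: "x \<in> cspan n S"
  shows "B *\<^sub>v x \<in> M"
  using cspan_minimal[OF csubspace_preimage[OF B M], of S] S gen x by auto

lemma csubspace_orthogonal:
  assumes y: "y \<in> carrier_vec n"
  shows "csubspace n {x \<in> carrier_vec n. x \<bullet>c y = 0}"
  using y by (intro csubspaceI) (auto simp: add_scalar_prod_distrib[of _ n])

lemma csubspace_orthogonal':
  assumes x: "x \<in> carrier_vec n"
  shows "csubspace n {y \<in> carrier_vec n. x \<bullet>c y = 0}"
  using x by (intro csubspaceI)
    (auto simp: conjugate_add_vec[of _ n] scalar_prod_add_distrib[of _ n] conjugate_smult_vec)

lemma cspan_mult_mat_vec:
  assumes U: "U \<in> carrier_mat n m" and z: "z \<in> carrier_vec m"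
  shows "U *\<^sub>v z \<in> cspan n (set (cols U))"
proof -
  interpret vec_space "TYPE(complex)" n .
  show ?thesis using col_space_eq[OF U] U z unfolding col_space_def by auto
qed

section \<open>Adjoints and isometries\<close>

lemma dim_mat_adjoint [simp]:
  "dim_row (B\<^sup>H) = dim_col B" "dim_col (B\<^sup>H) = dim_row B"
  by (simp_all add: mat_adjoint_def)

lemma mat_adjoint_carrier [simp]: "B \<in> carrier_mat n m \<Longrightarrow> B\<^sup>H \<in> carrier_mat m n"
  by (intro carrier_matI) auto

lemma index_mat_adjoint [simp]:
  "i < dim_col B \<Longrightarrow> j < dim_row B \<Longrightarrow> B\<^sup>H $$ (i, j) = conjugate (B $$ (j, i))"
  by (simp add: mat_adjoint_def mat_of_rows_def)

lemma mat_adjoint_adjoint [simp]: "(B\<^sup>H)\<^sup>H = (B :: complex mat)"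
  by (intro eq_matI) auto

lemma mult_mat_vec_cinner:
  fixes B :: "complex mat"
  assumes B: "B \<in> carrier_mat n m" and x: "x \<in> carrier_vec m" and y: "y \<in> carrier_vec n"
  shows "(B *\<^sub>v x) \<bullet>c y = x \<bullet>c (B\<^sup>H *\<^sub>v y)"
proof -
  have "(B *\<^sub>v x) \<bullet>c y = (\<Sum>i<n. \<Sum>j<m. B $$ (i, j) * x $ j * cnj (y $ i))"
    using B x y by (simp add: scalar_prod_def atLeast0LessThan sum_distrib_right)
  also have "\<dots> = (\<Sum>j<m. \<Sum>i<n. B $$ (i, j) * x $ j * cnj (y $ i))"
    by (rule sum.swap)
  also have "\<dots> = (\<Sum>j<m. x $ j * cnj ((B\<^sup>H *\<^sub>v y) $ j))"
    using B y by (intro sum.cong refl)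
      (simp add: scalar_prod_def atLeast0LessThan sum_distrib_left mult_ac)
  also have "\<dots> = x \<bullet>c (B\<^sup>H *\<^sub>v y)"
    using B by (simp add: scalar_prod_def atLeast0LessThan)
  finally show ?thesis .
qed

lemma index_adjoint_mult:
  fixes U V :: "complex mat"
  assumes "U \<in> carrier_mat n k" "V \<in> carrier_mat n m" "i < k" "j < m"
  shows "(U\<^sup>H * V) $$ (i, j) = col V j \<bullet>c col U i"
proof -
  have "(U\<^sup>H * V) $$ (i, j) = (\<Sum>r = 0..<n. cnj (U $$ (r, i)) * V $$ (r, j))"
    using assms by (simp add: scalar_prod_def)
  also have "\<dots> = col V j \<bullet>c col U i"
    using assms by (simp add: scalar_prod_def mult.commute)
  finally show ?thesis .
qed

lemma isometry_cinner_cols: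
  fixes U :: "complex mat"
  assumes U: "U \<in> carrier_mat n d" and iso: "U\<^sup>H * U = 1\<^sub>m d" and ij: "i < d" "j < d"
  shows "col U i \<bullet>c col U j = (if i = j then 1 else 0)"
  using index_adjoint_mult[OF U U ij(2,1)] ij by (auto simp: iso)

lemma isometry_cols_independent:
  fixes U :: "complex mat"
  assumes U: "U \<in> carrier_mat n d" and iso: "U\<^sup>H * U = 1\<^sub>m d"
  shows "distinct (cols U)"
    and "module.lin_indpt class_ring (module_vec TYPE(complex) n) (set (cols U))"
proof -
  interpret vec_space "TYPE(complex)" n .
  have inj: "z = 0\<^sub>v d" if "z \<in> carrier_vec d" "U *\<^sub>v z = 0\<^sub>v n" for z
  proof -
    have "z = (U\<^sup>H * U) *\<^sub>v z" using that by (simp add: iso)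
    also have "\<dots> = U\<^sup>H *\<^sub>v 0\<^sub>v n" using U that by (simp add: assoc_mult_mat_vec[of _ d n _ d])
    also have "\<dots> = 0\<^sub>v d" using U by (intro eq_vecI) (auto simp: scalar_prod_def)
    finally show ?thesis .
  qed
  have "col U i \<noteq> col U j" if "i < d" "j < d" "i \<noteq> j" for i j
    using isometry_cinner_cols[OF U iso that(1,1)] isometry_cinner_cols[OF U iso that(1,2)] that(3)
    by auto
  then show dist: "distinct (cols U)"
    using U unfolding distinct_conv_nth by simp
  show "lin_indpt (set (cols U))"
  proof
    assume "lin_dep (set (cols U))"
    from lin_depE[OF U this dist] inj show False by blast
  qed
qed

text \<open>The columns of an isometry are independent, so their number is the rank of the space that they
span. For the Lanczos process this says that block sizes cannot grow: a new block has at most as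
many columns as the residual, and the residual has as many as the preceding block.\<close>

lemma orthonormal_basis_mat_dim_col_le:
  assumes U: "orthonormal_basis_mat n U (ccol_space n W)" and W: "W \<in> carrier_mat n m"
  shows "dim_col U \<le> m"
proof -
  interpret vec_space "TYPE(complex)" n .
  have U': "U \<in> carrier_mat n (dim_col U)" "U\<^sup>H * U = 1\<^sub>m (dim_col U)"
    and eq: "span (set (cols U)) = span (set (cols W))"
    using U unfolding orthonormal_basis_mat_def col_space_def by auto
  have "rank U = rank W" unfolding rank_def eq ..
  then show ?thesis
    using lin_indpt_full_rank[OF U'(1) isometry_cols_independent[OF U']] rank_le_nc[OF W]
    by linarith
qed

lemma isometry_dim_le:
  fixes U :: "complex mat"
  assumes U: "U \<in> carrier_mat n d" and iso: "U\<^sup>H * U = 1\<^sub>m d"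
  shows "d \<le> n"
proof -
  interpret vec_space "TYPE(complex)" n .
  have "card (set (cols U)) \<le> n"
    using li_le_dim(2)[OF fin_dim _ isometry_cols_independent(2)[OF U iso]] cols_dim[of U] U
    by (simp add: dim_is_n)
  then show ?thesis
    using distinct_card[OF isometry_cols_independent(1)[OF U iso]] U by simp
qed

section \<open>Krylov subspaces\<close>

context
  fixes n l :: nat and H Z :: "complex mat"
  assumes H: "H \<in> carrier_mat n n" and Z: "Z \<in> carrier_mat n l"
begin

text \<open>Powers of a matrix are defined by multiplication from the right. Krylov generators need the new
factor on the left, where it acts on the vector \<open>H ^\<^sub>m i *\<^sub>v z\<close>.\<close>

lemma pow_mat_mult_left: "H ^\<^sub>m Suc i = H * H ^\<^sub>m i"
proof (induction i)
  case (Suc i)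
  have "H ^\<^sub>m Suc (Suc i) = H * H ^\<^sub>m i * H" using Suc by simp
  also have "\<dots> = H * H ^\<^sub>m Suc i" using H by (simp add: assoc_mult_mat[of _ n n _ n _ n])
  finally show ?case .
qed (use H in simp)

lemma krylov_altdef:
  "krylov n j H Z = cspan n {H ^\<^sub>m i *\<^sub>v z |i z. i < j \<and> z \<in> set (cols Z)}"
proof -
  have "set (cols (H ^\<^sub>m i * Z)) = (\<lambda>z. H ^\<^sub>m i *\<^sub>v z) ` set (cols Z)" for i
  proof -
    have "cols (H ^\<^sub>m i * Z) = map (\<lambda>z. H ^\<^sub>m i *\<^sub>v z) (cols Z)"
      using H Z by (intro nth_equalityI) (auto simp: col_mult2[of _ n n _ l])
    then show ?thesis by simp
  qed
  then have "(\<Union>i<j. set (cols (H ^\<^sub>m i * Z))) = {H ^\<^sub>m i *\<^sub>v z |i z. i < j \<and> z \<in> set (cols Z)}"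
    by auto
  then show ?thesis by (simp add: krylov_def)
qed

lemma cols_Z_carrier: "z \<in> set (cols Z) \<Longrightarrow> z \<in> carrier_vec n"
  using cols_dim[of Z] Z by auto

lemma krylov_generators_carrier:
  "{H ^\<^sub>m i *\<^sub>v z |i z. i < j \<and> z \<in> set (cols Z)} \<subseteq> carrier_vec n"
  using H cols_Z_carrier by (auto intro!: mult_mat_vec_carrier)

lemma csubspace_krylov: "csubspace n (krylov n j H Z)"
  unfolding krylov_altdef by (rule csubspace_cspan[OF krylov_generators_carrier])

lemma krylov_generator:
  "i < j \<Longrightarrow> z \<in> set (cols Z) \<Longrightarrow> H ^\<^sub>m i *\<^sub>v z \<in> krylov n j H Z"
  unfolding krylov_altdef using cspan_superset[OF krylov_generators_carrier] by blast

lemma krylov_minimal: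
  assumes "csubspace n M"
    and "\<And>i z. i < j \<Longrightarrow> z \<in> set (cols Z) \<Longrightarrow> H ^\<^sub>m i *\<^sub>v z \<in> M"
  shows "krylov n j H Z \<subseteq> M"
  unfolding krylov_altdef using assms by (intro cspan_minimal) auto

lemma krylov_mono: "i \<le> j \<Longrightarrow> krylov n i H Z \<subseteq> krylov n j H Z"
  by (intro krylov_minimal csubspace_krylov krylov_generator) auto

lemma krylov_1: "krylov n (Suc 0) H Z = cspan n (set (cols Z))"
proof -
  have "1\<^sub>m n * Z = Z" using Z by simp
  then show ?thesis using H by (simp add: krylov_def lessThan_Suc)
qed

lemma krylov_mult_mat:
  assumes B: "B \<in> carrier_mat n n" and M: "csubspace n M"
    and gen: "\<And>i z. i < j \<Longrightarrow> z \<in> set (cols Z) \<Longrightarrow> B *\<^sub>v (H ^\<^sub>m i *\<^sub>v z) \<in> M"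
    and x: "x \<in> krylov n j H Z"
  shows "B *\<^sub>v x \<in> M"
  using cspan_image_subset[OF B M krylov_generators_carrier _ x[unfolded krylov_altdef]] gen
  by blast

lemma pow_Suc_mult_mat_vec:
  "z \<in> set (cols Z) \<Longrightarrow> H ^\<^sub>m Suc i *\<^sub>v z = H *\<^sub>v (H ^\<^sub>m i *\<^sub>v z)"
  unfolding pow_mat_mult_left using H cols_Z_carrier
  by (intro assoc_mult_mat_vec[of _ n n _ n]) auto

lemma krylov_Suc_mult:
  assumes "x \<in> krylov n j H Z"
  shows "H *\<^sub>v x \<in> krylov n (Suc j) H Z"
proof (rule krylov_mult_mat[OF H csubspace_krylov _ assms])
  fix i z assume "i < j" "z \<in> set (cols Z)"
  then show "H *\<^sub>v (H ^\<^sub>m i *\<^sub>v z) \<in> krylov n (Suc j) H Z"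
    using krylov_generator[of "Suc i" "Suc j" z] pow_Suc_mult_mat_vec[of z i] by simp
qed

text \<open>If \<open>B\<close> were to commute with \<open>H\<close>, then \<open>B (H\<^bsup>i\<^esup> z) = H\<^bsup>i\<^esup> (B z)\<close>, and it would be enough to know that \<open>B\<close> sends
the columns of \<open>Z\<close> into the second Krylov subspace. The hypothesis \<open>step\<close> is the part of commutation
that the induction on \<open>i\<close> uses, and a perturbation of low rank does not spoil it.\<close>

lemma krylov_shift:
  assumes B: "B \<in> carrier_mat n n"
    and base: "\<And>z. z \<in> set (cols Z) \<Longrightarrow> B *\<^sub>v z \<in> krylov n 2 H Z"
    and step: "\<And>j x. x \<in> carrier_vec n \<Longrightarrow> B *\<^sub>v x \<in> krylov n (Suc j) H Z \<Longrightarrow>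
      B *\<^sub>v (H *\<^sub>v x) \<in> krylov n (Suc (Suc j)) H Z"
    and x: "x \<in> krylov n j H Z"
  shows "B *\<^sub>v x \<in> krylov n (Suc j) H Z"
proof -
  have gen: "B *\<^sub>v (H ^\<^sub>m i *\<^sub>v z) \<in> krylov n (Suc (Suc i)) H Z" if z: "z \<in> set (cols Z)" for i z
  proof (induction i)
    case 0
    have "1\<^sub>m n *\<^sub>v z = z" using cols_Z_carrier[OF z] by simp
    then show ?case using base[OF z] H by (simp add: numeral_2_eq_2)
  next
    case (Suc i)
    have "H ^\<^sub>m i *\<^sub>v z \<in> carrier_vec n"
      using H cols_Z_carrier[OF z] by (intro mult_mat_vec_carrier[of _ n n]) auto
    from step[OF this Suc] show ?case unfolding pow_Suc_mult_mat_vec[OF z] .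
  qed
  show ?thesis
  proof (rule krylov_mult_mat[OF B csubspace_krylov _ x])
    fix i z assume "i < j" and z: "z \<in> set (cols Z)"
    then show "B *\<^sub>v (H ^\<^sub>m i *\<^sub>v z) \<in> krylov n (Suc j) H Z"
      using gen[OF z, of i] krylov_mono[of "Suc (Suc i)" "Suc j"] by auto
  qed
qed

end

lemma krylov_subset_krylov:
  assumes H: "H \<in> carrier_mat n n" and Z: "Z \<in> carrier_mat n l" and S: "S \<in> carrier_mat n n"
    and shift: "\<And>j x. x \<in> krylov n j H Z \<Longrightarrow> S *\<^sub>v x \<in> krylov n (Suc j) H Z"
  shows "krylov n j S Z \<subseteq> krylov n j H Z"
proof (rule krylov_minimal[OF S Z csubspace_krylov[OF H Z]])
  fix i z assume i: "i < j" and z: "z \<in> set (cols Z)"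
  have "S ^\<^sub>m i *\<^sub>v z \<in> krylov n (Suc i) H Z"
  proof (induction i)
    case 0
    have "1\<^sub>m n *\<^sub>v z = z" using cols_Z_carrier[OF S Z z] by simp
    then show ?case using krylov_generator[OF H Z _ z, of 0 "Suc 0"] S H by simp
  next
    case (Suc i)
    then show ?case unfolding pow_Suc_mult_mat_vec[OF S Z z] by (rule shift)
  qed
  then show "S ^\<^sub>m i *\<^sub>v z \<in> krylov n j H Z"
    using krylov_mono[OF H Z, of "Suc i" j] i by auto
qed

section \<open>Rank-one perturbations of normal matrices on a quadric\<close>

lemma smult_mat_mult_vec:
  fixes B :: "complex mat"
  assumes "B \<in> carrier_mat n m" "x \<in> carrier_vec m"
  shows "(c \<cdot>\<^sub>m B) *\<^sub>v x = c \<cdot>\<^sub>v (B *\<^sub>v x)"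
  using assms by (intro eq_vecI) (auto simp: scalar_prod_def sum_distrib_left mult.assoc)

lemma outer_product_mult_vec:
  fixes u v x :: "complex vec"
  assumes "u \<in> carrier_vec n" "v \<in> carrier_vec n" "x \<in> carrier_vec n"
  shows "(mat_of_cols n [u] * (mat_of_cols n [v])\<^sup>H) *\<^sub>v x = (x \<bullet>c v) \<cdot>\<^sub>v u"
  using assms by (intro eq_vecI)
    (auto simp: scalar_prod_def mat_of_cols_index sum_distrib_left sum_distrib_right mult_ac)

lemma outer_product_adjoint:
  fixes u v :: "complex vec"
  assumes "u \<in> carrier_vec n" "v \<in> carrier_vec n"
  shows "(mat_of_cols n [u] * (mat_of_cols n [v])\<^sup>H)\<^sup>H = mat_of_cols n [v] * (mat_of_cols n [u])\<^sup>H"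
  using assms by (intro eq_matI)
    (auto simp: scalar_prod_def mat_of_cols_index mult_ac)

lemma mat_adjoint_add:
  fixes B C :: "complex mat"
  assumes "B \<in> carrier_mat n m" "C \<in> carrier_mat n m"
  shows "(B + C)\<^sup>H = B\<^sup>H + C\<^sup>H"
  using assms by (intro eq_matI) auto

text \<open>The coefficient of \<open>N\<^bsup>j\<^esup> (N\<^sup>H)\<^bsup>k\<^esup>\<close> in the quadric is \<open>a\<^sub>j\<^sub>k\<close>. Throughout the locale, \<open>K j\<close> is the Krylov
subspace generated by the Hermitian part; the columns of \<open>Z\<close> span \<open>K 1\<close>.\<close>

locale perturbed_normal_quadric =
  fixes n l :: nat and A N Z :: "complex mat" and u v :: "complex vec"
    and a\<^sub>2\<^sub>0 a\<^sub>1\<^sub>1 a\<^sub>0\<^sub>2 a\<^sub>1\<^sub>0 a\<^sub>0\<^sub>1 a\<^sub>0\<^sub>0 :: complex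
  assumes N: "N \<in> carrier_mat n n" and u: "u \<in> carrier_vec n" and v: "v \<in> carrier_vec n"
    and A_eq: "A = N + mat_of_cols n [u] * (mat_of_cols n [v])\<^sup>H"
    and normal: "N * N\<^sup>H = N\<^sup>H * N"
    and quadric: "a\<^sub>2\<^sub>0 \<cdot>\<^sub>m (N * N) + a\<^sub>1\<^sub>1 \<cdot>\<^sub>m (N * N\<^sup>H) + a\<^sub>0\<^sub>2 \<cdot>\<^sub>m (N\<^sup>H * N\<^sup>H)
      + a\<^sub>1\<^sub>0 \<cdot>\<^sub>m N + a\<^sub>0\<^sub>1 \<cdot>\<^sub>m N\<^sup>H + a\<^sub>0\<^sub>0 \<cdot>\<^sub>m 1\<^sub>m n = 0\<^sub>m n n"
    and nondegenerate: "a\<^sub>2\<^sub>0 + a\<^sub>0\<^sub>2 - a\<^sub>1\<^sub>1 \<noteq> 0"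
    and Z: "Z \<in> carrier_mat n l"
    and span_Z: "cspan n (set (cols Z)) =
      cspan n {u, v, A\<^sup>H *\<^sub>v u, A\<^sup>H *\<^sub>v v, A *\<^sub>v u, A *\<^sub>v v}"
begin

abbreviation K :: "nat \<Rightarrow> complex vec set" where
  "K j \<equiv> krylov n j (herm_part A) Z"

lemma carrier_A: "A \<in> carrier_mat n n"
  unfolding A_eq using N by (intro carrier_matI; simp)

lemma herm_carrier: "herm_part A \<in> carrier_mat n n"
  unfolding herm_part_def using carrier_A by (intro smult_carrier_mat add_carrier_mat mat_adjoint_carrier)

lemma antiherm_carrier: "antiherm_part A \<in> carrier_mat n n"
  unfolding antiherm_part_def using carrier_A by (intro smult_carrier_mat minus_carrier_mat mat_adjoint_carrier)

lemma K_subspace: "csubspace n (K j)"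
  by (rule csubspace_krylov[OF herm_carrier Z])

lemmas K_carrier = csubspace_carrier[OF K_subspace]
  and K_add = csubspace_add[OF K_subspace]
  and K_diff = csubspace_diff[OF K_subspace]
  and K_smult = csubspace_smult[OF K_subspace]

lemma N_mult_carrier [simp]:
  "x \<in> carrier_vec n \<Longrightarrow> N *\<^sub>v x \<in> carrier_vec n" "x \<in> carrier_vec n \<Longrightarrow> N\<^sup>H *\<^sub>v x \<in> carrier_vec n"
  using N by (auto intro!: mult_mat_vec_carrier)

lemma A_mult_carrier [simp]:
  "x \<in> carrier_vec n \<Longrightarrow> A *\<^sub>v x \<in> carrier_vec n" "x \<in> carrier_vec n \<Longrightarrow> A\<^sup>H *\<^sub>v x \<in> carrier_vec n"
  using carrier_A by (auto intro!: mult_mat_vec_carrier)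

lemma A_mult:
  assumes x: "x \<in> carrier_vec n"
  shows "A *\<^sub>v x = N *\<^sub>v x + (x \<bullet>c v) \<cdot>\<^sub>v u"
proof -
  have "mat_of_cols n [u] * (mat_of_cols n [v])\<^sup>H \<in> carrier_mat n n" by (intro carrier_matI; simp)
  then show ?thesis
    unfolding A_eq using add_mult_distrib_mat_vec[OF N _ x] outer_product_mult_vec[OF u v x] by simp
qed

lemma adjoint_A_mult:
  assumes x: "x \<in> carrier_vec n"
  shows "A\<^sup>H *\<^sub>v x = N\<^sup>H *\<^sub>v x + (x \<bullet>c u) \<cdot>\<^sub>v v"
proof -
  have 1: "mat_of_cols n [u] * (mat_of_cols n [v])\<^sup>H \<in> carrier_mat n n"
    and 2: "mat_of_cols n [v] * (mat_of_cols n [u])\<^sup>H \<in> carrier_mat n n" by (intro carrier_matI; simp)+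
  have "A\<^sup>H = N\<^sup>H + mat_of_cols n [v] * (mat_of_cols n [u])\<^sup>H"
    unfolding A_eq mat_adjoint_add[OF N 1] outer_product_adjoint[OF u v] ..
  then show ?thesis
    using add_mult_distrib_mat_vec[OF mat_adjoint_carrier[OF N] 2 x] outer_product_mult_vec[OF v u x]
    by simp
qed

lemma herm_mult:
  assumes x: "x \<in> carrier_vec n"
  shows "herm_part A *\<^sub>v x = (1/2) \<cdot>\<^sub>v (A *\<^sub>v x + A\<^sup>H *\<^sub>v x)"
  using smult_mat_mult_vec[of "A + A\<^sup>H" n n x "1/2"] carrier_A x
    add_mult_distrib_mat_vec[OF carrier_A mat_adjoint_carrier[OF carrier_A] x]
  by (simp add: herm_part_def add_carrier_mat)

lemma antiherm_mult:
  assumes x: "x \<in> carrier_vec n"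
  shows "antiherm_part A *\<^sub>v x = (1/2) \<cdot>\<^sub>v (A *\<^sub>v x - A\<^sup>H *\<^sub>v x)"
  using smult_mat_mult_vec[of "A - A\<^sup>H" n n x "1/2"] x minus_carrier_mat[OF mat_adjoint_carrier[OF carrier_A]]
    minus_mult_distrib_mat_vec[OF carrier_A mat_adjoint_carrier[OF carrier_A] x]
  by (simp add: antiherm_part_def)

lemma normal_mult:
  assumes x: "x \<in> carrier_vec n"
  shows "N\<^sup>H *\<^sub>v (N *\<^sub>v x) = N *\<^sub>v (N\<^sup>H *\<^sub>v x)"
  using assoc_mult_mat_vec[OF mat_adjoint_carrier[OF N] N x]
    assoc_mult_mat_vec[OF N mat_adjoint_carrier[OF N] x] normal by simp

lemma quadric_mult:
  assumes x: "x \<in> carrier_vec n"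
  shows "a\<^sub>2\<^sub>0 \<cdot>\<^sub>v (N *\<^sub>v (N *\<^sub>v x)) + a\<^sub>1\<^sub>1 \<cdot>\<^sub>v (N *\<^sub>v (N\<^sup>H *\<^sub>v x)) + a\<^sub>0\<^sub>2 \<cdot>\<^sub>v (N\<^sup>H *\<^sub>v (N\<^sup>H *\<^sub>v x))
    + a\<^sub>1\<^sub>0 \<cdot>\<^sub>v (N *\<^sub>v x) + a\<^sub>0\<^sub>1 \<cdot>\<^sub>v (N\<^sup>H *\<^sub>v x) + a\<^sub>0\<^sub>0 \<cdot>\<^sub>v x = 0\<^sub>v n"
proof -
  note NH = mat_adjoint_carrier[OF N]
  have "0\<^sub>v n = 0\<^sub>m n n *\<^sub>v x" using x by (intro eq_vecI) (auto simp: scalar_prod_def)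
  also have "\<dots> = a\<^sub>2\<^sub>0 \<cdot>\<^sub>v (N *\<^sub>v (N *\<^sub>v x)) + a\<^sub>1\<^sub>1 \<cdot>\<^sub>v (N *\<^sub>v (N\<^sup>H *\<^sub>v x)) + a\<^sub>0\<^sub>2 \<cdot>\<^sub>v (N\<^sup>H *\<^sub>v (N\<^sup>H *\<^sub>v x))
    + a\<^sub>1\<^sub>0 \<cdot>\<^sub>v (N *\<^sub>v x) + a\<^sub>0\<^sub>1 \<cdot>\<^sub>v (N\<^sup>H *\<^sub>v x) + a\<^sub>0\<^sub>0 \<cdot>\<^sub>v x"
    unfolding quadric[symmetric]
    using N NH x mult_carrier_mat[OF N N] mult_carrier_mat[OF N NH] mult_carrier_mat[OF NH NH]
    by (simp add: add_mult_distrib_mat_vec[of _ n n] smult_mat_mult_vec[of _ n n]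
        assoc_mult_mat_vec[of _ n n _ n])
  finally show ?thesis by simp
qed

lemma initial_vectors:
  "u \<in> K (Suc j)" "v \<in> K (Suc j)" "A *\<^sub>v u \<in> K (Suc j)" "A *\<^sub>v v \<in> K (Suc j)"
  "A\<^sup>H *\<^sub>v u \<in> K (Suc j)" "A\<^sup>H *\<^sub>v v \<in> K (Suc j)"
proof -
  have "{u, v, A\<^sup>H *\<^sub>v u, A\<^sup>H *\<^sub>v v, A *\<^sub>v u, A *\<^sub>v v} \<subseteq> K (Suc 0)"
    unfolding krylov_1[OF herm_carrier Z] span_Z using u v by (intro cspan_superset) auto
  then have "{u, v, A\<^sup>H *\<^sub>v u, A\<^sup>H *\<^sub>v v, A *\<^sub>v u, A *\<^sub>v v} \<subseteq> K (Suc j)"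
    using krylov_mono[OF herm_carrier Z, of "Suc 0" "Suc j"] by blast
  then show "u \<in> K (Suc j)" "v \<in> K (Suc j)" "A *\<^sub>v u \<in> K (Suc j)" "A *\<^sub>v v \<in> K (Suc j)"
    "A\<^sup>H *\<^sub>v u \<in> K (Suc j)" "A\<^sup>H *\<^sub>v v \<in> K (Suc j)" by auto
qed

lemma N_initial_vectors:
  assumes w: "w \<in> {u, v}"
  shows "w \<in> K (Suc j)" "N *\<^sub>v w \<in> K (Suc j)" "N\<^sup>H *\<^sub>v w \<in> K (Suc j)"
proof -
  have wc: "w \<in> carrier_vec n" using w u v by auto
  show "w \<in> K (Suc j)" using w initial_vectors by auto
  have "N *\<^sub>v w = A *\<^sub>v w - (w \<bullet>c v) \<cdot>\<^sub>v u"
    using A_mult[OF wc] u N wc by (intro eq_vecI) auto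
  moreover have "A *\<^sub>v w \<in> K (Suc j)" using w initial_vectors by auto
  ultimately show "N *\<^sub>v w \<in> K (Suc j)"
    using K_diff K_smult initial_vectors(1) by metis
  have "N\<^sup>H *\<^sub>v w = A\<^sup>H *\<^sub>v w - (w \<bullet>c u) \<cdot>\<^sub>v v"
    using adjoint_A_mult[OF wc] v N wc by (intro eq_vecI) auto
  moreover have "A\<^sup>H *\<^sub>v w \<in> K (Suc j)" using w initial_vectors by auto
  ultimately show "N\<^sup>H *\<^sub>v w \<in> K (Suc j)"
    using K_diff K_smult initial_vectors(2) by metis
qed

lemma herm_mult':
  assumes x: "x \<in> carrier_vec n"
  shows "herm_part A *\<^sub>v x = (1/2) \<cdot>\<^sub>v (N *\<^sub>v x + N\<^sup>H *\<^sub>v x + ((x \<bullet>c v) \<cdot>\<^sub>v u + (x \<bullet>c u) \<cdot>\<^sub>v v))"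
  using herm_mult[OF x] A_mult[OF x] adjoint_A_mult[OF x] N u v x by (intro eq_vecI) auto

text \<open>\<open>N + N\<^sup>H\<close> differs from twice the Hermitian part of \<open>A\<close> by a matrix with range in the span of \<open>u\<close>
and \<open>v\<close>, and this span lies in every \<open>K (j + 1)\<close>.\<close>

lemma N_plus_adjoint_shift:
  assumes x: "x \<in> K j"
  shows "N *\<^sub>v x + N\<^sup>H *\<^sub>v x \<in> K (Suc j)"
proof -
  note xc = K_carrier[OF x]
  have "N *\<^sub>v x + N\<^sup>H *\<^sub>v x
      = 2 \<cdot>\<^sub>v (herm_part A *\<^sub>v x) - ((x \<bullet>c v) \<cdot>\<^sub>v u + (x \<bullet>c u) \<cdot>\<^sub>v v)"
    using herm_mult'[OF xc] N u v xc by (intro eq_vecI) (auto simp: add_divide_distrib)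
  moreover have "herm_part A *\<^sub>v x \<in> K (Suc j)" by (rule krylov_Suc_mult[OF herm_carrier Z x])
  ultimately show ?thesis
    using K_diff K_add K_smult initial_vectors(1,2) by metis
qed

text \<open>This is the only use of the quadric. Put \<open>p = N N w\<close>, \<open>q = N N\<^sup>H w = N\<^sup>H N w\<close> and \<open>r = N\<^sup>H N\<^sup>H w\<close>.
Applying \<open>N + N\<^sup>H\<close> to \<open>N w\<close> and to \<open>N\<^sup>H w\<close> gives \<open>p + q\<close> and \<open>q + r\<close> in \<open>K (j + 1)\<close>, so modulo \<open>K (j + 1)\<close>
both \<open>p\<close> and \<open>r\<close> equal \<open>- q\<close>. The quadric, applied to \<open>w\<close>, then reads
\<open>(a\<^sub>1\<^sub>1 - a\<^sub>2\<^sub>0 - a\<^sub>0\<^sub>2) q = 0\<close> modulo \<open>K (j + 1)\<close>, and the scalar is nonzero.\<close>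

lemma quadric_shift:
  assumes w: "w \<in> K j" "N *\<^sub>v w \<in> K j" "N\<^sup>H *\<^sub>v w \<in> K j"
  shows "N *\<^sub>v (N *\<^sub>v w) \<in> K (Suc j)" "N *\<^sub>v (N\<^sup>H *\<^sub>v w) \<in> K (Suc j)"
proof -
  note wc = K_carrier[OF w(1)]
  define p q r where "p = N *\<^sub>v (N *\<^sub>v w)" and "q = N *\<^sub>v (N\<^sup>H *\<^sub>v w)" and "r = N\<^sup>H *\<^sub>v (N\<^sup>H *\<^sub>v w)"
  define x y where "x = N *\<^sub>v w" and "y = N\<^sup>H *\<^sub>v w"
  have c: "p \<in> carrier_vec n" "q \<in> carrier_vec n" "r \<in> carrier_vec n"
    "x \<in> carrier_vec n" "y \<in> carrier_vec n"
    unfolding p_def q_def r_def x_def y_def using wc by simp_all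
  have pq: "p + q \<in> K (Suc j)"
    using N_plus_adjoint_shift[OF w(2)] by (simp add: p_def q_def normal_mult[OF wc])
  have qr: "q + r \<in> K (Suc j)"
    using N_plus_adjoint_shift[OF w(3)] by (simp add: q_def r_def)
  define s where "s = a\<^sub>2\<^sub>0 \<cdot>\<^sub>v (p + q) + a\<^sub>0\<^sub>2 \<cdot>\<^sub>v (q + r)
      + (a\<^sub>1\<^sub>0 \<cdot>\<^sub>v x + a\<^sub>0\<^sub>1 \<cdot>\<^sub>v y + a\<^sub>0\<^sub>0 \<cdot>\<^sub>v w)"
  have sub: "K j \<subseteq> K (Suc j)" by (intro krylov_mono[OF herm_carrier Z]) simp
  have sK: "s \<in> K (Suc j)"
    unfolding s_def
    by (intro K_add[OF K_add[OF K_smult[OF pq] K_smult[OF qr]]] K_add[OF K_add] K_smult)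
      (use w sub in \<open>auto simp: x_def y_def\<close>)
  have s: "dim_vec s = n" using K_carrier[OF sK] by auto
  \<comment> \<open>Solve the quadric for \<open>q\<close>, with \<open>p\<close> and \<open>r\<close> written as \<open>(p + q) - q\<close> and \<open>(q + r) - q\<close>.\<close>
  have "q = (1 / (a\<^sub>2\<^sub>0 + a\<^sub>0\<^sub>2 - a\<^sub>1\<^sub>1)) \<cdot>\<^sub>v s"
  proof (intro eq_vecI)
    fix i assume "i < dim_vec ((1 / (a\<^sub>2\<^sub>0 + a\<^sub>0\<^sub>2 - a\<^sub>1\<^sub>1)) \<cdot>\<^sub>v s)"
    then have i: "i < n" using s by simp
    have "(a\<^sub>2\<^sub>0 \<cdot>\<^sub>v p + a\<^sub>1\<^sub>1 \<cdot>\<^sub>v q + a\<^sub>0\<^sub>2 \<cdot>\<^sub>v r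
        + a\<^sub>1\<^sub>0 \<cdot>\<^sub>v x + a\<^sub>0\<^sub>1 \<cdot>\<^sub>v y + a\<^sub>0\<^sub>0 \<cdot>\<^sub>v w) $ i = 0"
      using quadric_mult[OF wc] i unfolding p_def q_def r_def x_def y_def by simp
    then have rel: "a\<^sub>2\<^sub>0 * p $ i + a\<^sub>1\<^sub>1 * q $ i + a\<^sub>0\<^sub>2 * r $ i
        + a\<^sub>1\<^sub>0 * x $ i + a\<^sub>0\<^sub>1 * y $ i + a\<^sub>0\<^sub>0 * w $ i = 0"
      using c wc i by (simp add: add.assoc)
    have "s $ i = a\<^sub>2\<^sub>0 * (p $ i + q $ i) + a\<^sub>0\<^sub>2 * (q $ i + r $ i)
        + (a\<^sub>1\<^sub>0 * x $ i + a\<^sub>0\<^sub>1 * y $ i + a\<^sub>0\<^sub>0 * w $ i)"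
      unfolding s_def using c wc i by simp
    also have "\<dots> = (a\<^sub>2\<^sub>0 + a\<^sub>0\<^sub>2 - a\<^sub>1\<^sub>1) * q $ i
        + (a\<^sub>2\<^sub>0 * p $ i + a\<^sub>1\<^sub>1 * q $ i + a\<^sub>0\<^sub>2 * r $ i
          + a\<^sub>1\<^sub>0 * x $ i + a\<^sub>0\<^sub>1 * y $ i + a\<^sub>0\<^sub>0 * w $ i)"
      by (simp add: distrib_left distrib_right left_diff_distrib)
    finally show "q $ i = ((1 / (a\<^sub>2\<^sub>0 + a\<^sub>0\<^sub>2 - a\<^sub>1\<^sub>1)) \<cdot>\<^sub>v s) $ i"
      using nondegenerate i s rel by simp
  qed (use c s in simp)
  then have q: "q \<in> K (Suc j)" using K_smult[OF sK] by simp
  have "p = p + q - q" using c by (intro eq_vecI) auto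
  then have "p \<in> K (Suc j)" using K_diff[OF pq q] by simp
  with q show "N *\<^sub>v (N *\<^sub>v w) \<in> K (Suc j)" "N *\<^sub>v (N\<^sup>H *\<^sub>v w) \<in> K (Suc j)"
    by (simp_all add: p_def q_def)
qed

text \<open>Up to multiples of \<open>N u\<close> and \<open>N v\<close>, the matrix \<open>N\<close> sends the generators \<open>A w\<close> and \<open>A\<^sup>H w\<close> (with \<open>w\<close>
one of \<open>u\<close>, \<open>v\<close>) to \<open>N N w\<close> and \<open>N N\<^sup>H w\<close>. This is where the choice of the starting space matters: it
contains \<open>w\<close>, \<open>N w\<close> and \<open>N\<^sup>H w\<close>, the three vectors that the quadric argument starts from.\<close>

lemma N_initial_shift:
  assumes z: "z \<in> set (cols Z)"
  shows "N *\<^sub>v z \<in> K 2"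
proof (rule cspan_image_subset[OF N K_subspace])
  let ?D = "{u, v, A\<^sup>H *\<^sub>v u, A\<^sup>H *\<^sub>v v, A *\<^sub>v u, A *\<^sub>v v}"
  show "?D \<subseteq> carrier_vec n" using u v by auto
  have "set (cols Z) \<subseteq> carrier_vec n" using cols_dim[of Z] Z by auto
  then show "z \<in> cspan n ?D" using z cspan_superset span_Z by blast
  have uv: "N *\<^sub>v u \<in> K 2" "N *\<^sub>v v \<in> K 2"
    using N_initial_vectors(2)[of _ 1] by (simp_all add: numeral_2_eq_2)
  have "N *\<^sub>v (A *\<^sub>v w) \<in> K 2 \<and> N *\<^sub>v (A\<^sup>H *\<^sub>v w) \<in> K 2" if w: "w \<in> {u, v}" for w
  proof -
    have wc: "w \<in> carrier_vec n" using w u v by auto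
    have "N *\<^sub>v (A *\<^sub>v w) = N *\<^sub>v (N *\<^sub>v w) + (w \<bullet>c v) \<cdot>\<^sub>v (N *\<^sub>v u)"
      unfolding A_mult[OF wc] using N u wc
      by (simp add: mult_add_distrib_mat_vec[OF N] mult_mat_vec[OF N])
    moreover have "N *\<^sub>v (A\<^sup>H *\<^sub>v w) = N *\<^sub>v (N\<^sup>H *\<^sub>v w) + (w \<bullet>c u) \<cdot>\<^sub>v (N *\<^sub>v v)"
      unfolding adjoint_A_mult[OF wc] using N v wc
      by (simp add: mult_add_distrib_mat_vec[OF N] mult_mat_vec[OF N])
    moreover have "N *\<^sub>v (N *\<^sub>v w) \<in> K 2" "N *\<^sub>v (N\<^sup>H *\<^sub>v w) \<in> K 2"
      using quadric_shift[OF N_initial_vectors[OF w, of 0]] by (simp_all add: numeral_2_eq_2)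
    ultimately show ?thesis using K_add K_smult uv by metis
  qed
  then show "N *\<^sub>v s \<in> K 2" if "s \<in> ?D" for s using that uv by auto
qed

text \<open>\<open>N\<close> commutes with \<open>N + N\<^sup>H\<close>, hence with \<open>H = herm_part A\<close> up to an error whose range lies in
the span of \<open>u\<close>, \<open>v\<close>, \<open>N u\<close> and \<open>N v\<close>, which are vectors of \<open>K 1\<close>.\<close>

lemma N_shift:
  assumes "x \<in> K j"
  shows "N *\<^sub>v x \<in> K (Suc j)"
proof (rule krylov_shift[OF herm_carrier Z N N_initial_shift _ assms])
  fix j x assume x: "x \<in> carrier_vec n" and Nx: "N *\<^sub>v x \<in> K (Suc j)"
  have "N *\<^sub>v (herm_part A *\<^sub>v x)
      = (1/2) \<cdot>\<^sub>v (N *\<^sub>v (N *\<^sub>v x) + N\<^sup>H *\<^sub>v (N *\<^sub>v x)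
          + ((x \<bullet>c v) \<cdot>\<^sub>v (N *\<^sub>v u) + (x \<bullet>c u) \<cdot>\<^sub>v (N *\<^sub>v v)))"
    unfolding herm_mult'[OF x] normal_mult[OF x] using x u v
    by (simp add: mult_add_distrib_mat_vec[OF N] mult_mat_vec[OF N])
  then show "N *\<^sub>v (herm_part A *\<^sub>v x) \<in> K (Suc (Suc j))"
    using N_plus_adjoint_shift[OF Nx] N_initial_vectors(2)[of _ "Suc j"] K_add K_smult by simp
qed

lemma A_shift:
  assumes x: "x \<in> K j"
  shows "A *\<^sub>v x \<in> K (Suc j)"
  unfolding A_mult[OF K_carrier[OF x]]
  by (intro K_add K_smult N_shift[OF x] initial_vectors)

lemma adjoint_A_shift:
  assumes x: "x \<in> K j"
  shows "A\<^sup>H *\<^sub>v x \<in> K (Suc j)"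
proof -
  note xc = K_carrier[OF x]
  have "A\<^sup>H *\<^sub>v x = 2 \<cdot>\<^sub>v (herm_part A *\<^sub>v x) - A *\<^sub>v x"
    unfolding herm_mult[OF xc] using xc carrier_A by (intro eq_vecI) (auto simp: add_divide_distrib)
  then show ?thesis
    using K_diff[OF K_smult[OF krylov_Suc_mult[OF herm_carrier Z x]] A_shift[OF x]] by simp
qed

lemma antiherm_shift:
  assumes x: "x \<in> K j"
  shows "antiherm_part A *\<^sub>v x \<in> K (Suc j)"
  unfolding antiherm_mult[OF K_carrier[OF x]]
  by (intro K_smult K_diff A_shift[OF x] adjoint_A_shift[OF x])

lemma adjoint_antiherm_shift:
  assumes x: "x \<in> K j"
  shows "(antiherm_part A)\<^sup>H *\<^sub>v x \<in> K (Suc j)"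
proof -
  have "(antiherm_part A)\<^sup>H = (-1) \<cdot>\<^sub>m antiherm_part A"
    using carrier_A unfolding antiherm_part_def by (intro eq_matI) auto
  then have "(antiherm_part A)\<^sup>H *\<^sub>v x = (-1) \<cdot>\<^sub>v (antiherm_part A *\<^sub>v x)"
    using smult_mat_mult_vec[OF antiherm_carrier K_carrier[OF x]] by simp
  then show ?thesis using K_smult[OF antiherm_shift[OF x]] by simp
qed

end

section \<open>Concatenated blocks of orthonormal columns\<close>

lemma cinner_swap:
  fixes x y :: "complex vec"
  assumes "x \<in> carrier_vec n" "y \<in> carrier_vec n"
  shows "y \<bullet>c x = cnj (x \<bullet>c y)"
  using assms by (simp add: scalar_prod_def mult.commute)

lemma set_cols: "set (cols B) = col B ` {..<dim_col B}"
  by (simp add: cols_def atLeast0LessThan)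

definition orthonormal_list :: "complex vec list \<Rightarrow> bool" where
  "orthonormal_list cs \<longleftrightarrow>
     (\<forall>i<length cs. \<forall>j<length cs. cs ! i \<bullet>c cs ! j = (if i = j then 1 else 0))"

lemma orthonormal_list_append:
  assumes "orthonormal_list xs" "orthonormal_list ys"
    and "\<And>x y. x \<in> set xs \<Longrightarrow> y \<in> set ys \<Longrightarrow> x \<bullet>c y = 0"
    and "\<And>x y. x \<in> set xs \<Longrightarrow> y \<in> set ys \<Longrightarrow> y \<bullet>c x = 0"
  shows "orthonormal_list (xs @ ys)"
  unfolding orthonormal_list_def
proof (intro allI impI)
  fix i j assume ij: "i < length (xs @ ys)" "j < length (xs @ ys)"
  show "(xs @ ys) ! i \<bullet>c (xs @ ys) ! j = (if i = j then 1 else 0)"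
  proof (cases "i < length xs"; cases "j < length xs")
    assume "\<not> i < length xs" "\<not> j < length xs"
    moreover from this ij have "i - length xs < length ys" "j - length xs < length ys" by auto
    ultimately show ?thesis
      using assms(2) unfolding orthonormal_list_def by (auto simp: nth_append)
  qed (use ij assms in \<open>auto simp: nth_append orthonormal_list_def\<close>)
qed

lemma orthonormal_list_cols:
  fixes U :: "complex mat"
  assumes "U\<^sup>H * U = 1\<^sub>m (dim_col U)"
  shows "orthonormal_list (cols U)"
  using isometry_cinner_cols[OF carrier_matI[OF refl refl] assms]
  by (simp add: orthonormal_list_def)

lemma mat_of_cols_isometry:
  assumes cs: "set cs \<subseteq> carrier_vec n" and orth: "orthonormal_list cs"
  shows "(mat_of_cols n cs)\<^sup>H * mat_of_cols n cs = 1\<^sub>m (length cs)"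
proof (intro eq_matI)
  fix i j assume ij: "i < dim_row (1\<^sub>m (length cs))" "j < dim_col (1\<^sub>m (length cs))"
  then have "cs ! i \<in> carrier_vec n" "cs ! j \<in> carrier_vec n" using cs by auto
  then show "((mat_of_cols n cs)\<^sup>H * mat_of_cols n cs) $$ (i, j) = 1\<^sub>m (length cs) $$ (i, j)"
    using ij orth index_adjoint_mult[of "mat_of_cols n cs" n "length cs" "mat_of_cols n cs" "length cs" i j]
    by (auto simp: orthonormal_list_def)
qed simp_all

text \<open>When \<open>xss\<close> lists the columns of the blocks, the offset is the global index that occurs in
\<^const>\<open>block_tridiagonal\<close>.\<close>

lemma concat_nth_block:
  assumes "p < length xss" "r < length (xss ! p)"
  shows "sum_list (map length (take p xss)) + r < length (concat xss)"
    and "concat xss ! (sum_list (map length (take p xss)) + r) = xss ! p ! r"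
proof -
  have "concat xss = concat (take p xss) @ xss ! p @ concat (drop (Suc p) xss)"
    using id_take_nth_drop[OF assms(1)] by (metis concat.simps(2) concat_append)
  moreover have "sum_list (map length (take p xss)) = length (concat (take p xss))"
    by (simp add: length_concat)
  ultimately show "sum_list (map length (take p xss)) + r < length (concat xss)"
    and "concat xss ! (sum_list (map length (take p xss)) + r) = xss ! p ! r"
    using assms(2) by (simp_all add: nth_append)
qed

lemma hcat_carrier: "hcat n Us \<in> carrier_mat n (total_cols Us)"
  by (intro carrier_matI) (simp_all add: hcat_def total_cols_def length_concat comp_def)

lemma col_hcat:
  assumes rows: "\<And>U. U \<in> set Us \<Longrightarrow> dim_row U = n" and p: "p < length Us" and r: "r < dim_col (Us ! p)"
  shows "sum_list (take p (map dim_col Us)) + r < total_cols Us"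
    and "col (hcat n Us) (sum_list (take p (map dim_col Us)) + r) = col (Us ! p) r"
proof -
  let ?css = "map cols Us" and ?I = "sum_list (take p (map dim_col Us)) + r"
  have I: "?I = sum_list (map length (take p ?css)) + r"
    by (simp add: take_map comp_def)
  have "length (concat ?css) = total_cols Us"
    by (simp add: length_concat total_cols_def comp_def)
  then show lt: "?I < total_cols Us"
    using concat_nth_block(1)[of p ?css r] p r unfolding I by simp
  have nth: "concat ?css ! ?I = col (Us ! p) r"
    using concat_nth_block(2)[of p ?css r] p r unfolding I by simp
  have "col (Us ! p) r \<in> carrier_vec n"
    using rows[of "Us ! p"] p by auto
  then show "col (hcat n Us) ?I = col (Us ! p) r"
    using lt nth unfolding hcat_def
    by (subst col_mat_of_cols) (simp_all add: length_concat total_cols_def comp_def)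
qed

text \<open>\<open>B B\<^sup>H\<close> is the orthogonal projection onto the column space of \<open>B\<close>, so it preserves inner products
with vectors of that space.\<close>

lemma isometry_projection_cinner:
  fixes B :: "complex mat"
  assumes B: "B \<in> carrier_mat n d" and iso: "B\<^sup>H * B = 1\<^sub>m d"
    and h: "h \<in> carrier_vec n" and r: "r < d"
  shows "(B *\<^sub>v (B\<^sup>H *\<^sub>v h)) \<bullet>c col B r = h \<bullet>c col B r"
proof -
  have c: "col B r \<in> carrier_vec n" using B r by auto
  have "B\<^sup>H *\<^sub>v col B r = col (B\<^sup>H * B) r"
    using col_mult2[OF mat_adjoint_carrier[OF B] B r] by simp
  then have e: "B *\<^sub>v (B\<^sup>H *\<^sub>v col B r) = col B r"
    using col_mult2[OF B one_carrier_mat r] B iso by simp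
  have "(B *\<^sub>v (B\<^sup>H *\<^sub>v h)) \<bullet>c col B r = (B\<^sup>H *\<^sub>v h) \<bullet>c (B\<^sup>H *\<^sub>v col B r)"
    using B h c by (intro mult_mat_vec_cinner) (auto intro!: mult_mat_vec_carrier)
  also have "\<dots> = h \<bullet>c ((B\<^sup>H)\<^sup>H *\<^sub>v (B\<^sup>H *\<^sub>v col B r))"
    using B h c by (intro mult_mat_vec_cinner) (auto intro!: mult_mat_vec_carrier)
  finally show ?thesis by (simp add: e)
qed

lemma range_orthogonal:
  fixes B :: "complex mat"
  assumes B: "B \<in> carrier_mat n d" and z: "z \<in> carrier_vec d" and y: "y \<in> carrier_vec n"
    and orth: "\<And>x. x \<in> set (cols B) \<Longrightarrow> x \<bullet>c y = 0"
  shows "(B *\<^sub>v z) \<bullet>c y = 0"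
proof -
  have "set (cols B) \<subseteq> carrier_vec n" using cols_dim[of B] B by auto
  then have "cspan n (set (cols B)) \<subseteq> {x \<in> carrier_vec n. x \<bullet>c y = 0}"
    using orth by (intro cspan_minimal[OF csubspace_orthogonal[OF y]]) auto
  then show ?thesis using cspan_mult_mat_vec[OF B z] by auto
qed

section \<open>The block Lanczos process\<close>

abbreviation block_cols :: "complex mat list \<Rightarrow> complex vec set" where
  "block_cols Us \<equiv> (\<Union>U\<in>set Us. set (cols U))"

text \<open>The invariant of the process: the blocks are isometries with at most \<open>l\<close> columns, the first \<open>k\<close> of
them span the \<open>k\<close>-th Krylov subspace, and each block is orthogonal to the Krylov subspace spanned by
its predecessors. Indices start at 0, so the predecessors of block \<open>p\<close> span \<open>krylov n p H Z\<close> and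
block \<open>p\<close> itself lies in \<open>krylov n (Suc p) H Z\<close>.\<close>

definition lanczos_blocks :: "nat \<Rightarrow> nat \<Rightarrow> complex mat \<Rightarrow> complex mat \<Rightarrow> complex mat list \<Rightarrow> bool" where
  "lanczos_blocks n l H Z Us \<longleftrightarrow> Us \<noteq> [] \<and>
     (\<forall>U\<in>set Us. dim_row U = n \<and> dim_col U \<le> l \<and> U\<^sup>H * U = 1\<^sub>m (dim_col U)) \<and>
     (\<forall>p<length Us. \<forall>x\<in>set (cols (Us ! p)). \<forall>y\<in>krylov n p H Z. x \<bullet>c y = 0) \<and>
     (\<forall>k\<le>length Us. cspan n (block_cols (take k Us)) = krylov n k H Z)"

locale lanczos =
  fixes n l :: nat and H Z :: "complex mat" and Us :: "complex mat list"
  assumes H: "H \<in> carrier_mat n n" and herm: "H\<^sup>H = H" and Z: "Z \<in> carrier_mat n l"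
    and blocks: "lanczos_blocks n l H Z Us"
begin

abbreviation "K j \<equiv> krylov n j H Z"

lemmas K_subspace = csubspace_krylov[OF H Z]
lemmas K_carrier = csubspace_carrier[OF K_subspace]

lemma nonempty: "Us \<noteq> []"
  using blocks by (simp add: lanczos_blocks_def)

lemma block:
  assumes "p < length Us"
  shows block_carrier: "Us ! p \<in> carrier_mat n (dim_col (Us ! p))"
    and block_isometry: "(Us ! p)\<^sup>H * Us ! p = 1\<^sub>m (dim_col (Us ! p))"
    and block_dim_col_le: "dim_col (Us ! p) \<le> l"
  using blocks nth_mem[OF assms] by (auto simp: lanczos_blocks_def)

lemma block_col_carrier:
  assumes "p < length Us"
  shows "col (Us ! p) c \<in> carrier_vec n"
  using carrier_matD(1)[OF block_carrier[OF assms]] by (intro carrier_vecI) simp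

lemma col_orthogonal_krylov:
  assumes "p < length Us" "x \<in> set (cols (Us ! p))" "y \<in> K q" "q \<le> p"
  shows "x \<bullet>c y = 0"
  using blocks assms krylov_mono[OF H Z assms(4)] unfolding lanczos_blocks_def by blast

lemma block_cols_carrier: "block_cols (take k Us) \<subseteq> carrier_vec n"
proof
  fix x assume "x \<in> block_cols (take k Us)"
  then obtain U where "U \<in> set Us" "x \<in> set (cols U)" by (auto dest: in_set_takeD)
  moreover from this have "dim_row U = n" using blocks by (auto simp: lanczos_blocks_def)
  ultimately show "x \<in> carrier_vec n" using cols_dim[of U] by auto
qed

lemma span_blocks: "k \<le> length Us \<Longrightarrow> cspan n (block_cols (take k Us)) = K k"
  using blocks by (simp add: lanczos_blocks_def)

lemma span_all_blocks: "cspan n (block_cols Us) = K (length Us)"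
  using span_blocks[of "length Us"] by simp

lemma col_krylov:
  assumes p: "p < length Us" and x: "x \<in> set (cols (Us ! p))"
  shows "x \<in> K (Suc p)"
proof -
  have "Us ! p \<in> set (take (Suc p) Us)" using p by (simp add: take_Suc_conv_app_nth)
  then have "x \<in> cspan n (block_cols (take (Suc p) Us))"
    using cspan_superset[OF block_cols_carrier] x by blast
  then show ?thesis using span_blocks[of "Suc p"] p by simp
qed

lemma block_cols_orthogonal:
  assumes p: "p < length Us" and q: "q < length Us" and neq: "p \<noteq> q"
    and x: "x \<in> set (cols (Us ! p))" and y: "y \<in> set (cols (Us ! q))"
  shows "x \<bullet>c y = 0"
proof (cases "q < p")
  case True
  then show ?thesis using col_orthogonal_krylov[OF p x col_krylov[OF q y]] by simp
next
  case False
  then have "y \<bullet>c x = 0" using col_orthogonal_krylov[OF q y col_krylov[OF p x]] neq by simp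
  then show ?thesis
    using cinner_swap[OF K_carrier[OF col_krylov[OF q y]] K_carrier[OF col_krylov[OF p x]]] by simp
qed

lemma hcat_isometry: "(hcat n Us)\<^sup>H * hcat n Us = 1\<^sub>m (total_cols Us)"
proof -
  have orth: "orthonormal_list (concat (map cols (take k Us)))" if "k \<le> length Us" for k
    using that
  proof (induction k)
    case 0
    then show ?case by (simp add: orthonormal_list_def)
  next
    case (Suc k)
    then have k: "k < length Us" by simp
    have "orthonormal_list (concat (map cols (take k Us)) @ cols (Us ! k))"
    proof (rule orthonormal_list_append)
      show "orthonormal_list (concat (map cols (take k Us)))" using Suc by simp
      show "orthonormal_list (cols (Us ! k))"
        by (rule orthonormal_list_cols[OF block_isometry[OF k]])
      fix x y assume "x \<in> set (concat (map cols (take k Us)))" and y: "y \<in> set (cols (Us ! k))"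
      then obtain V where "V \<in> set (take k Us)" "x \<in> set (cols V)" by auto
      then obtain q where q: "q < k" "x \<in> set (cols (Us ! q))"
        using k by (metis in_set_conv_nth length_take min.absorb4 nth_take)
      show "x \<bullet>c y = 0" "y \<bullet>c x = 0"
        using block_cols_orthogonal[of q k x y] block_cols_orthogonal[of k q y x] q k y by simp_all
    qed
    then show ?case using k by (simp add: take_Suc_conv_app_nth)
  qed
  have "set (concat (map cols Us)) \<subseteq> carrier_vec n"
    using block_cols_carrier[of "length Us"] by auto
  from mat_of_cols_isometry[OF this] orth[of "length Us"]
  have "(hcat n Us)\<^sup>H * hcat n Us = 1\<^sub>m (dim_col (hcat n Us))"
    by (simp add: hcat_def)
  then show ?thesis using hcat_carrier[of n Us] by simp
qed

text \<open>Orthonormal columns are independent, so a run cannot collect more than \<open>n\<close> of them; once it has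
collected \<open>n\<close>, the isometry is square and hence unitary.\<close>

lemma unitary_hcat:
  assumes full: "n \<le> total_cols Us"
  shows "unitary_mat n (hcat n Us)"
proof -
  have "total_cols Us = n"
    using full isometry_dim_le[OF hcat_carrier hcat_isometry] by simp
  then have U: "hcat n Us \<in> carrier_mat n n" and iso: "(hcat n Us)\<^sup>H * hcat n Us = 1\<^sub>m n"
    using hcat_carrier[of n Us] hcat_isometry by simp_all
  show ?thesis
    using U iso mat_mult_left_right_inverse[OF mat_adjoint_carrier[OF U] U iso]
    by (simp add: unitary_mat_def)
qed

text \<open>The entries of block \<open>(p, q)\<close> are inner products of \<open>B x\<close> with \<open>y\<close>, for columns \<open>x\<close> of block \<open>q\<close> and \<open>y\<close>
of block \<open>p\<close>. As \<open>x\<close> lies in \<open>K (q + 1)\<close>, the vector \<open>B x\<close> lies in \<open>K (q + 2)\<close>, to which block \<open>p\<close> is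
orthogonal when \<open>q + 1 < p\<close>. Above the diagonal the same argument applies to \<open>x\<close> and \<open>B\<^sup>H y\<close>.\<close>

lemma block_tridiagonal_hcat:
  assumes B: "B \<in> carrier_mat n n"
    and shift: "\<And>j x. x \<in> K j \<Longrightarrow> B *\<^sub>v x \<in> K (Suc j)"
    and adjoint_shift: "\<And>j x. x \<in> K j \<Longrightarrow> B\<^sup>H *\<^sub>v x \<in> K (Suc j)"
  shows "block_tridiagonal (map dim_col Us) ((hcat n Us)\<^sup>H * B * hcat n Us)"
proof -
  let ?U = "hcat n Us" and ?s = "map dim_col Us"
  have U: "?U \<in> carrier_mat n (total_cols Us)" by (rule hcat_carrier)
  have assoc: "?U\<^sup>H * B * ?U = ?U\<^sup>H * (B * ?U)"
    using assoc_mult_mat[OF mat_adjoint_carrier[OF U] B U] .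
  have entry: "(?U\<^sup>H * B * ?U) $$ (sum_list (take p ?s) + r, sum_list (take q ?s) + c) = 0"
    if p: "p < length Us" and q: "q < length Us" and r: "r < dim_col (Us ! p)" and c: "c < dim_col (Us ! q)"
      and far: "p + 1 < q \<or> q + 1 < p" for p q r c
  proof -
    have rows: "\<And>U. U \<in> set Us \<Longrightarrow> dim_row U = n" using blocks by (simp add: lanczos_blocks_def)
    let ?x = "col (Us ! q) c" and ?y = "col (Us ! p) r"
    have x: "?x \<in> set (cols (Us ! q))" and y: "?y \<in> set (cols (Us ! p))"
      using r c by (auto simp: set_cols)
    note xK = col_krylov[OF q x] and yK = col_krylov[OF p y]
    have "(?U\<^sup>H * B * ?U) $$ (sum_list (take p ?s) + r, sum_list (take q ?s) + c) = (B *\<^sub>v ?x) \<bullet>c ?y"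
      unfolding assoc
      using index_adjoint_mult[OF U mult_carrier_mat[OF B U] col_hcat(1)[OF rows p r] col_hcat(1)[OF rows q c]]
        col_mult2[OF B U col_hcat(1)[OF rows q c]] col_hcat(2)[OF rows p r] col_hcat(2)[OF rows q c]
      by simp
    also have "\<dots> = 0"
    proof (cases "q + 1 < p")
      case True
      then have "?y \<bullet>c (B *\<^sub>v ?x) = 0"
        using col_orthogonal_krylov[OF p y shift[OF xK]] by simp
      then show ?thesis
        using cinner_swap[OF K_carrier[OF yK] K_carrier[OF shift[OF xK]]] by simp
    next
      case False
      then have "?x \<bullet>c (B\<^sup>H *\<^sub>v ?y) = 0"
        using col_orthogonal_krylov[OF q x adjoint_shift[OF yK]] far by simp
      then show ?thesis
        using mult_mat_vec_cinner[OF B K_carrier[OF xK] K_carrier[OF yK]] by simp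
    qed
    finally show ?thesis .
  qed
  have "?U\<^sup>H * B * ?U \<in> carrier_mat (sum_list ?s) (sum_list ?s)"
    using U B unfolding total_cols_def[symmetric] by (metis mat_adjoint_carrier mult_carrier_mat)
  then show ?thesis
    using entry unfolding block_tridiagonal_def by (auto simp del: take_map)
qed

abbreviation "W \<equiv> lanczos_residual H Us"

lemma col_projection:
  assumes p: "p < length Us" and q: "q < length Us" and c: "c < dim_col (Us ! q)"
  shows "col (Us ! p * (Us ! p)\<^sup>H * H * Us ! q) c
      = Us ! p *\<^sub>v ((Us ! p)\<^sup>H *\<^sub>v (H *\<^sub>v col (Us ! q) c))"
proof -
  note P = block_carrier[OF p] and Q = block_carrier[OF q]
  note P' = mat_adjoint_carrier[OF P]
  have x: "col (Us ! q) c \<in> carrier_vec n" by (rule block_col_carrier[OF q])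
  have PP: "Us ! p * (Us ! p)\<^sup>H \<in> carrier_mat n n" by (rule mult_carrier_mat[OF P P'])
  show "col (Us ! p * (Us ! p)\<^sup>H * H * Us ! q) c
      = Us ! p *\<^sub>v ((Us ! p)\<^sup>H *\<^sub>v (H *\<^sub>v col (Us ! q) c))"
    using col_mult2[OF mult_carrier_mat[OF PP H] Q c] assoc_mult_mat_vec[OF PP H x]
      assoc_mult_mat_vec[OF P P' mult_mat_vec_carrier[OF H x]] by simp
qed

definition proj :: "nat \<Rightarrow> complex vec \<Rightarrow> complex vec" where
  "proj p h = Us ! p *\<^sub>v ((Us ! p)\<^sup>H *\<^sub>v h)"

lemma proj_krylov:
  assumes p: "p < length Us" and h: "h \<in> carrier_vec n"
  shows "proj p h \<in> K (Suc p)"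
proof -
  note P = block_carrier[OF p]
  have "proj p h \<in> cspan n (set (cols (Us ! p)))"
    unfolding proj_def using mult_mat_vec_carrier[OF mat_adjoint_carrier[OF P] h]
    by (rule cspan_mult_mat_vec[OF P])
  moreover have "cspan n (set (cols (Us ! p))) \<subseteq> K (Suc p)"
    using col_krylov[OF p] by (intro cspan_minimal[OF K_subspace]) auto
  ultimately show ?thesis by auto
qed

lemma proj_cinner:
  assumes p: "p < length Us" and q: "q < length Us" and h: "h \<in> carrier_vec n"
    and y: "y \<in> set (cols (Us ! q))"
  shows "proj p h \<bullet>c y = (if p = q then h \<bullet>c y else 0)"
proof (cases "p = q")
  case True
  obtain r where "r < dim_col (Us ! q)" "y = col (Us ! q) r" using y by (auto simp: set_cols)
  then show ?thesis
    using isometry_projection_cinner[OF block_carrier[OF q] block_isometry[OF q] h] True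
    by (simp add: proj_def)
next
  case False
  have "(Us ! p *\<^sub>v ((Us ! p)\<^sup>H *\<^sub>v h)) \<bullet>c y = 0"
    using block_cols_orthogonal[OF p q False _ y]
    by (intro range_orthogonal[OF block_carrier[OF p] _ K_carrier[OF col_krylov[OF q y]]]
        mult_mat_vec_carrier[OF mat_adjoint_carrier[OF block_carrier[OF p]] h])
  then show ?thesis using False by (simp add: proj_def)
qed

lemma residual:
  assumes m: "length Us = Suc m"
  shows residual_carrier: "W \<in> carrier_mat n (dim_col (Us ! m))"
    and col_residual: "c < dim_col (Us ! m) \<Longrightarrow>
      col W c = H *\<^sub>v col (Us ! m) c - proj m (H *\<^sub>v col (Us ! m) c)
        - (if m = 0 then 0\<^sub>v n else proj (m - 1) (H *\<^sub>v col (Us ! m) c))"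
proof -
  let ?X = "Us ! m" and ?d = "dim_col (Us ! m)"
  let ?P = "\<lambda>p. Us ! p * (Us ! p)\<^sup>H * H * ?X"
  have mlt: "m < length Us" and m1lt: "m - 1 < length Us" using m by simp_all
  note X = block_carrier[OF mlt]
  have W_eq: "W = (if m = 0 then H * ?X - ?P m else H * ?X - ?P m - ?P (m - 1))"
    using m by (simp add: lanczos_residual_def Let_def)
  have HX: "H * ?X \<in> carrier_mat n ?d" by (rule mult_carrier_mat[OF H X])
  have P: "?P p \<in> carrier_mat n ?d" if "p < length Us" for p
    using mult_carrier_mat[OF mult_carrier_mat[OF mult_carrier_mat[OF block_carrier[OF that]
            mat_adjoint_carrier[OF block_carrier[OF that]]] H] X] .
  show W: "W \<in> carrier_mat n ?d"
    unfolding W_eq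
    by (split if_split) (intro conjI impI minus_carrier_mat[OF P[OF mlt]] minus_carrier_mat[OF P[OF m1lt]])
  assume c: "c < ?d"
  have col_diff: "col (C - D) c = col C c - col D c"
    if "C \<in> carrier_mat n ?d" "D \<in> carrier_mat n ?d" for C D :: "complex mat"
    using that c by (intro eq_vecI) auto
  have x: "col ?X c \<in> carrier_vec n" by (rule block_col_carrier[OF mlt])
  have zero: "h - g - 0\<^sub>v n = h - g" if "h \<in> carrier_vec n" "g \<in> carrier_vec n" for h g :: "complex vec"
    using that by (intro eq_vecI) auto
  have hc: "H *\<^sub>v col ?X c \<in> carrier_vec n" by (rule mult_mat_vec_carrier[OF H x])
  have colP: "col (?P p) c = proj p (H *\<^sub>v col ?X c)" if "p < length Us" for p
    using col_projection[OF that mlt c] by (simp add: proj_def)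
  have colHX: "col (H * ?X) c = H *\<^sub>v col ?X c" by (rule col_mult2[OF H X c])
  show "col W c = H *\<^sub>v col ?X c - proj m (H *\<^sub>v col ?X c)
        - (if m = 0 then 0\<^sub>v n else proj (m - 1) (H *\<^sub>v col ?X c))"
  proof (cases "m = 0")
    case True
    have "col W c = col (H * ?X) c - col (?P m) c"
      unfolding W_eq if_P[OF True] by (rule col_diff[OF HX P[OF mlt]])
    then show ?thesis
      unfolding if_P[OF True] colHX colP[OF mlt] zero[OF hc K_carrier[OF proj_krylov[OF mlt hc]]] .
  next
    case False
    have "col W c = col (H * ?X) c - col (?P m) c - col (?P (m - 1)) c"
      unfolding W_eq if_not_P[OF False] col_diff[OF minus_carrier_mat[OF P[OF mlt]] P[OF m1lt]]
        col_diff[OF HX P[OF mlt]] ..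
    then show ?thesis unfolding if_not_P[OF False] colHX colP[OF mlt] colP[OF m1lt] .
  qed
qed

lemma residual_remainder:
  assumes m: "length Us = Suc m" and c: "c < dim_col (Us ! m)"
  obtains g where "g \<in> K (Suc m)" "col W c = H *\<^sub>v col (Us ! m) c - g"
proof -
  let ?h = "H *\<^sub>v col (Us ! m) c"
  let ?r = "if m = 0 then 0\<^sub>v n else proj (m - 1) ?h"
  have mlt: "m < length Us" using m by simp
  have h: "?h \<in> carrier_vec n"
    by (rule mult_mat_vec_carrier[OF H block_col_carrier[OF mlt]])
  have p: "proj m ?h \<in> K (Suc m)" by (rule proj_krylov[OF mlt h])
  have r: "?r \<in> K (Suc m)"
    using proj_krylov[OF _ h, of "m - 1"] m csubspace_zero[OF K_subspace]
      krylov_mono[OF H Z, of m "Suc m"] by auto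
  have "col W c = ?h - (proj m ?h + ?r)"
    unfolding col_residual[OF m c] using h K_carrier[OF p] K_carrier[OF r]
    by (intro eq_vecI) auto
  then show thesis using that csubspace_add[OF K_subspace p r] by blast
qed

text \<open>The process orthogonalizes \<open>h = H x\<close> against the last two blocks only. Against an earlier block \<open>q\<close>
nothing needs to be done: as \<open>H\<close> is Hermitian, the inner product of \<open>h\<close> with a column \<open>y\<close> of block \<open>q\<close>
is that of \<open>x\<close> with \<open>H y\<close>, and \<open>H y\<close> lies in \<open>K (q + 2)\<close>, which is orthogonal to the last block.\<close>

lemma residual_orthogonal:
  assumes m: "length Us = Suc m" and c: "c < dim_col (Us ! m)" and y: "y \<in> K (Suc m)"
  shows "col W c \<bullet>c y = 0"
proof -
  let ?x = "col (Us ! m) c"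
  let ?h = "H *\<^sub>v ?x"
  let ?r = "if m = 0 then 0\<^sub>v n else proj (m - 1) ?h"
  have mlt: "m < length Us" using m by simp
  have x: "?x \<in> set (cols (Us ! m))" using c by (auto simp: set_cols)
  have xc: "?x \<in> carrier_vec n" using K_carrier[OF col_krylov[OF mlt x]] .
  have h: "?h \<in> carrier_vec n" by (rule mult_mat_vec_carrier[OF H xc])
  have pc: "proj p ?h \<in> carrier_vec n" if "p < length Us" for p
    using K_carrier[OF proj_krylov[OF that h]] .
  have Wc: "col W c \<in> carrier_vec n" using residual_carrier[OF m] c by auto
  have gen: "col W c \<bullet>c y = 0" if y: "y \<in> block_cols Us" for y
  proof -
    obtain q where q: "q < length Us" "y \<in> set (cols (Us ! q))"
      using y by (metis UN_E in_set_conv_nth)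
    note yK = col_krylov[OF q]
    note yc = K_carrier[OF yK]
    have rc: "?r \<in> carrier_vec n" using pc[of "m - 1"] m by auto
    have "col W c \<bullet>c y = ?h \<bullet>c y - proj m ?h \<bullet>c y - ?r \<bullet>c y"
      unfolding col_residual[OF m c] using h pc[OF mlt] rc yc
      by (simp add: minus_scalar_prod_distrib[of _ n])
    also have "proj m ?h \<bullet>c y = (if m = q then ?h \<bullet>c y else 0)"
      by (rule proj_cinner[OF mlt q(1) h q(2)])
    also have "?r \<bullet>c y = (if m = Suc q then ?h \<bullet>c y else 0)"
      using proj_cinner[OF _ q(1) h q(2), of "m - 1"] m yc by auto
    also have "?h \<bullet>c y - (if m = q then ?h \<bullet>c y else 0) - (if m = Suc q then ?h \<bullet>c y else 0) = 0"
    proof (cases "m = q \<or> m = Suc q")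
      case False
      then have "Suc (Suc q) \<le> m" using q(1) m by simp
      then have "?x \<bullet>c (H *\<^sub>v y) = 0"
        by (rule col_orthogonal_krylov[OF mlt x krylov_Suc_mult[OF H Z yK]])
      then show ?thesis using False mult_mat_vec_cinner[OF H xc yc] herm by simp
    qed auto
    finally show ?thesis .
  qed
  have "cspan n (block_cols Us) \<subseteq> {y \<in> carrier_vec n. col W c \<bullet>c y = 0}"
    using gen block_cols_carrier[of "length Us"]
    by (intro cspan_minimal[OF csubspace_orthogonal'[OF Wc]]) auto
  then show ?thesis using y m unfolding span_all_blocks by auto
qed

text \<open>The new block inherits orthogonality from the residual. The old blocks together with the residual
span \<open>K (length Us + 1)\<close>, because a residual column is \<open>H x\<close> minus a vector of \<open>K (length Us)\<close>, where \<open>x\<close>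
is a column of the last block, and \<open>H\<close> maps all columns of the other blocks into \<open>K (length Us)\<close>.\<close>

lemma lanczos_blocks_extend:
  assumes U: "orthonormal_basis_mat n U (ccol_space n W)"
  shows "lanczos_blocks n l H Z (Us @ [U])"
proof -
  obtain m where m: "length Us = Suc m" using nonempty by (cases Us) auto
  have mlt: "m < length Us" using m by simp
  note Wc = residual_carrier[OF m]
  have U_row: "dim_row U = n" and U_iso: "U\<^sup>H * U = 1\<^sub>m (dim_col U)"
    and U_span: "cspan n (set (cols U)) = cspan n (set (cols W))"
    using U by (auto simp: orthonormal_basis_mat_def vec_space.col_space_def)
  have U_cols: "set (cols U) \<subseteq> carrier_vec n" using cols_dim[of U] U_row by simp
  have W_cols: "set (cols W) \<subseteq> carrier_vec n" using cols_dim[of W] Wc by simp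
  have U_W: "set (cols U) \<subseteq> cspan n (set (cols W))"
    using cspan_superset[OF U_cols] U_span by simp
  have U_le: "dim_col U \<le> l"
    using orthonormal_basis_mat_dim_col_le[OF U Wc] block_dim_col_le[OF mlt] by simp
  have orth: "x \<bullet>c y = 0" if x: "x \<in> set (cols U)" and y: "y \<in> K (length Us)" for x y
  proof -
    have "cspan n (set (cols W)) \<subseteq> {x \<in> carrier_vec n. x \<bullet>c y = 0}"
      using residual_orthogonal[OF m] y W_cols Wc m
      by (intro cspan_minimal[OF csubspace_orthogonal[OF K_carrier[OF y]]]) (auto simp: set_cols)
    then show ?thesis using x U_W by auto
  qed
  let ?T = "cspan n (block_cols (Us @ [U]))"
  have all_cols: "block_cols (Us @ [U]) \<subseteq> carrier_vec n"
    using block_cols_carrier[of "length Us"] U_cols by auto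
  note T = csubspace_cspan[OF all_cols] and T_gen = cspan_superset[OF all_cols]
  \<comment> \<open>The blocks of \<open>Us\<close> span \<open>K (Suc m)\<close>, as \<open>length Us = Suc m\<close>.\<close>
  have K_T: "K (Suc m) \<subseteq> ?T"
    unfolding m[symmetric] span_all_blocks[symmetric] using T_gen by (intro cspan_minimal[OF T]) auto
  have W_T: "cspan n (set (cols W)) \<subseteq> ?T"
    unfolding U_span[symmetric] using T_gen by (intro cspan_minimal[OF T]) auto
  have H_T: "H *\<^sub>v x \<in> ?T" if x: "x \<in> K (Suc m)" for x
  proof (rule cspan_image_subset[OF H T])
    show "block_cols Us \<subseteq> carrier_vec n" using block_cols_carrier[of "length Us"] by simp
    show "x \<in> cspan n (block_cols Us)" using x by (simp add: span_all_blocks m)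
    fix y assume "y \<in> block_cols Us"
    then obtain q where q: "q < length Us" "y \<in> set (cols (Us ! q))"
      by (metis UN_E in_set_conv_nth)
    show "H *\<^sub>v y \<in> ?T"
    proof (cases "q = m")
      case False
      then have "K (Suc (Suc q)) \<subseteq> K (Suc m)" using q(1) m by (intro krylov_mono[OF H Z]) simp
      then show ?thesis using krylov_Suc_mult[OF H Z col_krylov[OF q]] K_T by auto
    next
      case True
      then obtain c where c: "c < dim_col (Us ! m)" "y = col (Us ! m) c"
        using q(2) by (auto simp: set_cols)
      obtain g where g: "g \<in> K (Suc m)" "col W c = H *\<^sub>v y - g"
        using residual_remainder[OF m c(1)] c(2) by blast
      have "H *\<^sub>v y = col W c + g"
        unfolding g(2) using K_carrier[OF g(1)] K_carrier[OF col_krylov[OF q]] H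
        by (intro eq_vecI) auto
      moreover have "col W c \<in> ?T"
        using W_T cspan_superset[OF W_cols] c(1) Wc by (auto simp: set_cols)
      ultimately show ?thesis using csubspace_add[OF T] g(1) K_T by auto
    qed
  qed
  have span_new: "?T = K (Suc (length Us))"
  proof
    have "set (cols W) \<subseteq> K (Suc (Suc m))"
    proof
      fix w assume "w \<in> set (cols W)"
      then obtain c where c: "c < dim_col (Us ! m)" "w = col W c" using Wc by (auto simp: set_cols)
      obtain g where g: "g \<in> K (Suc m)" "col W c = H *\<^sub>v col (Us ! m) c - g"
        using residual_remainder[OF m c(1)] .
      have "col (Us ! m) c \<in> K (Suc m)" using c(1) by (intro col_krylov[OF mlt]) (simp add: set_cols)
      from krylov_Suc_mult[OF H Z this] g show "w \<in> K (Suc (Suc m))"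
        using csubspace_diff[OF K_subspace] krylov_mono[OF H Z, of "Suc m" "Suc (Suc m)"] c(2) by auto
    qed
    then have "cspan n (set (cols W)) \<subseteq> K (Suc (length Us))"
      unfolding m by (rule cspan_minimal[OF K_subspace])
    moreover have "block_cols Us \<subseteq> K (Suc (length Us))"
      using cspan_superset[OF block_cols_carrier[of "length Us"]] krylov_mono[OF H Z, of "length Us" "Suc (length Us)"]
      by (auto simp: span_all_blocks)
    ultimately show "?T \<subseteq> K (Suc (length Us))"
      using U_W by (intro cspan_minimal[OF K_subspace]) auto
    show "K (Suc (length Us)) \<subseteq> ?T"
    proof (rule krylov_minimal[OF H Z T])
      fix i z assume i: "i < Suc (length Us)" and z: "z \<in> set (cols Z)"
      show "H ^\<^sub>m i *\<^sub>v z \<in> ?T"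
      proof (cases "i < Suc m")
        case True
        then show ?thesis using krylov_generator[OF H Z _ z] K_T by blast
      next
        case False
        then have "i = Suc m" using i m by simp
        then show ?thesis
          using pow_Suc_mult_mat_vec[OF H Z z, of m] H_T[OF krylov_generator[OF H Z _ z, of m]] by simp
      qed
    qed
  qed
  have "cspan n (block_cols (take k (Us @ [U]))) = K k" if "k \<le> Suc (length Us)" for k
  proof (cases "k \<le> length Us")
    case True
    then show ?thesis using span_blocks by simp
  next
    case False
    then show ?thesis using that span_new by (simp add: le_Suc_eq)
  qed
  moreover have "x \<bullet>c y = 0"
    if "p < Suc (length Us)" "x \<in> set (cols ((Us @ [U]) ! p))" "y \<in> K p" for p x y
    using that orth col_orthogonal_krylov[OF _ _ that(3)] by (cases "p < length Us") (auto simp: nth_append less_Suc_eq)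
  ultimately show ?thesis
    using blocks U_row U_iso U_le unfolding lanczos_blocks_def by auto
qed

end

lemma lanczos_blocks_init:
  assumes H: "H \<in> carrier_mat n n" and Z: "Z \<in> carrier_mat n l"
    and U: "orthonormal_basis_mat n U (ccol_space n Z)"
  shows "lanczos_blocks n l H Z [U]"
proof -
  have U_row: "dim_row U = n" and U_iso: "U\<^sup>H * U = 1\<^sub>m (dim_col U)"
    and U_span: "cspan n (set (cols U)) = cspan n (set (cols Z))"
    using U by (auto simp: orthonormal_basis_mat_def vec_space.col_space_def)
  have K0: "krylov n 0 H Z = cspan n {}" by (simp add: krylov_def)
  have "cspan n {} \<subseteq> {0\<^sub>v n}"
    by (intro cspan_minimal csubspaceI) auto
  moreover have "x \<bullet>c 0\<^sub>v n = 0" if "x \<in> set (cols U)" for x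
    using that cols_dim[of U] U_row by auto
  ultimately have "\<forall>x\<in>set (cols U). \<forall>y\<in>krylov n 0 H Z. x \<bullet>c y = 0"
    unfolding K0 by auto
  moreover have "cspan n (block_cols (take k [U])) = krylov n k H Z" if "k \<le> 1" for k
    using that K0 U_span krylov_1[OF H Z] by (cases k) auto
  ultimately show ?thesis
    using U_row U_iso orthonormal_basis_mat_dim_col_le[OF U Z] by (simp add: lanczos_blocks_def)
qed

lemma block_lanczos_run_blocks:
  assumes "block_lanczos_run n l H Z Us" 
  shows "lanczos n l H Z Us"
  using assms
proof (induction rule: block_lanczos_run.induct)
  case (init U)
  then show ?case using lanczos_blocks_init by unfold_locales blast+
next
  case (step Us W U)
  interpret lanczos n l H Z Us by (rule step.IH)
  show ?case using H herm Z lanczos_blocks_extend step.hyps by unfold_locales blast+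
qed

theorem theorem10:
  fixes n l :: nat
    and A N Z :: "complex mat"
    and u v :: "complex vec"
    and a :: "nat \<Rightarrow> nat \<Rightarrow> complex"
  assumes "A \<in> carrier_mat n n" and "N \<in> carrier_mat n n"
    and "u \<in> carrier_vec n" and "v \<in> carrier_vec n"
    and "A = N + mat_of_cols n [u] * (mat_of_cols n [v])\<^sup>H"
    and "N * N\<^sup>H - N\<^sup>H * N = 0\<^sub>m n n"
    and "\<And>k j. k + j \<le> 2 \<Longrightarrow> a k j = cnj (a j k)"
    and "a 2 0 \<cdot>\<^sub>m (N * N) + a 1 1 \<cdot>\<^sub>m (N * N\<^sup>H) + a 0 2 \<cdot>\<^sub>m (N\<^sup>H * N\<^sup>H)
         + a 1 0 \<cdot>\<^sub>m N + a 0 1 \<cdot>\<^sub>m N\<^sup>H + a 0 0 \<cdot>\<^sub>m 1\<^sub>m n = 0\<^sub>m n n"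
    and "a 2 0 + a 0 2 - a 1 1 \<noteq> 0"
    and "Z \<in> carrier_mat n l" and "l \<le> 6"
    and "cspan n (set (cols Z)) =
         cspan n {u, v, A\<^sup>H *\<^sub>v u, A\<^sup>H *\<^sub>v v, A *\<^sub>v u, A *\<^sub>v v}"
  shows "(\<forall>j. krylov n j (antiherm_part A) Z \<subseteq> krylov n j (herm_part A) Z) \<and>
    (\<forall>Us. block_lanczos_completes n l (herm_part A) Z Us \<longrightarrow>
       (let U = hcat n Us; sizes = map dim_col Us in
          unitary_mat n U \<and>
          block_tridiagonal sizes (U\<^sup>H * herm_part A * U) \<and>
          block_tridiagonal sizes (U\<^sup>H * antiherm_part A * U) \<and>
          block_tridiagonal sizes (U\<^sup>H * A * U) \<and>
          (\<forall>i \<in> set sizes. i \<le> 6)))"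
proof (intro conjI allI impI)
  have normal: "N * N\<^sup>H = N\<^sup>H * N"
  proof (intro eq_matI)
    fix i j assume ij: "i < dim_row (N\<^sup>H * N)" "j < dim_col (N\<^sup>H * N)"
    then have "(N * N\<^sup>H - N\<^sup>H * N) $$ (i, j) = 0"
      using assms(2) unfolding assms(6) by simp
    then show "(N * N\<^sup>H) $$ (i, j) = (N\<^sup>H * N) $$ (i, j)"
      using ij by (simp del: index_mult_mat(1))
  qed (use assms(2) in simp_all)
  interpret perturbed_normal_quadric n l A N Z u v "a 2 0" "a 1 1" "a 0 2" "a 1 0" "a 0 1" "a 0 0"
    by unfold_locales (fact assms normal)+
  show "krylov n j (antiherm_part A) Z \<subseteq> krylov n j (herm_part A) Z" for j
    by (rule krylov_subset_krylov[OF herm_carrier Z antiherm_carrier antiherm_shift])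
  fix Us assume completes: "block_lanczos_completes n l (herm_part A) Z Us"
  then interpret L: lanczos n l "herm_part A" Z Us
    by (intro block_lanczos_run_blocks) (simp add: block_lanczos_completes_def)
  have unitary: "unitary_mat n (hcat n Us)"
    using completes by (intro L.unitary_hcat) (simp add: block_lanczos_completes_def)
  have herm_shift: "herm_part A *\<^sub>v x \<in> krylov n (Suc j) (herm_part A) Z"
    if "x \<in> krylov n j (herm_part A) Z" for j x
    by (rule krylov_Suc_mult[OF herm_carrier Z that])
  have "i \<le> 6" if "i \<in> set (map dim_col Us)" for i
    using that L.block_dim_col_le assms(11) by (force simp: in_set_conv_nth)
  moreover have "block_tridiagonal (map dim_col Us) ((hcat n Us)\<^sup>H * herm_part A * hcat n Us)"
    by (rule L.block_tridiagonal_hcat[OF herm_carrier]) (simp_all only: L.herm herm_shift)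
  moreover note L.block_tridiagonal_hcat[OF antiherm_carrier antiherm_shift adjoint_antiherm_shift]
    L.block_tridiagonal_hcat[OF carrier_A A_shift adjoint_A_shift]
  ultimately show "let U = hcat n Us; sizes = map dim_col Us in
          unitary_mat n U \<and>
          block_tridiagonal sizes (U\<^sup>H * herm_part A * U) \<and>
          block_tridiagonal sizes (U\<^sup>H * antiherm_part A * U) \<and>
          block_tridiagonal sizes (U\<^sup>H * A * U) \<and>
          (\<forall>i \<in> set sizes. i \<le> 6)"
    using unitary unfolding Let_def by blast
qed

end
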